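(* Let $\alpha,\beta,\gamma,a_1,\dots,a_n,b,c,d,x_1,\dots,x_n$ be complex parameters such that either $$\max\{|\alpha a_{1}\cdots a_{n}q^{1-n}|,|\alpha b|,|\alpha c|,|\alpha d|,|\alpha\beta a_{1}\cdots a_{n}/q^{n}|,|\alpha\gamma a_{1}\cdots a_{n}/q^{n}|\}<1,$$ or $a_r=q^{N_r}$ with $N_r$ a positive integer for $r=1,\dots,n$ (so that the series terminates). Suppose that none of the denominators in the following identity vanishes. Then $$\begin{aligned} & \frac{(\alpha q,\ \alpha a_{1}\cdots a_{n}b/q^{n},\ \alpha a_{1}\cdots a_{n}c/q^{n},\ \alpha a_{1}\cdots a_{n}d/q^{n},\ \alpha\beta,\ \alpha\gamma)_{\infty}}{(\alpha a_{1}\cdots a_{n}q^{1-n},\ \alpha b,\ \alpha c,\ \alpha d,\ \alpha\beta a_{1}\cdots a_{n}/q^{n},\ \alpha\gamma a_{1}\cdots a_{n}/q^{n})_{\infty}}\\ &=\sum_{k_1,\dots,k_n\ge0}\ \prod_{1\leq r<s\leq n}\frac{1-q^{k_{r}-k_{s}}x_{r}/x_{s}}{1-x_{r}/x_{s}}\prod_{r,s=1}^{n}\frac{(qx_{r}/(x_{s}a_{s}))_{k_{r}}}{(qx_{r}/x_{s})_{k_{r}}}\\ &\quad\times\frac{(1-\alpha q^{2|\boldsymbol{k}|})(\alpha)_{|\boldsymbol{k}|}}{(1-\alpha)(\alpha a_{1}\cdots a_{n}q^{1-n})_{|\boldsymbol{k}|}}(a_{1}\cdots a_{n})^{|\boldsymbol{k}|}q^{\sum_{r=1}^{n}(r-1)k_{r}-n|\boldsymbol{k}|}\\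 &\quad\times\sum_{\substack{0\leq m_{r}\leq k_{r}\\ r=1,\dots,n}}\ \prod_{1\leq r<s\leq n}\frac{1-q^{m_{r}-m_{s}}x_{r}/x_{s}}{1-x_{r}/x_{s}}\prod_{r,s=1}^{n}\frac{(q^{-k_{s}}x_{r}/x_{s})_{m_{r}}}{(qx_{r}/x_{s})_{m_{r}}}\cdot\frac{(\alpha q^{|\boldsymbol{k}|},\alpha\beta,\alpha\gamma)_{|\boldsymbol{m}|}}{(\alpha b,\alpha c,\alpha d)_{|\boldsymbol{m}|}}q^{\sum_{r=1}^{n}rm_{r}}. \end{aligned}$$
   Context: $q$ is a complex number with $0<|q|<1$ and $n\ge1$ is an integer. $(z)_\infty=\prod_{i\ge0}(1-zq^i)$ and $(z)_k=(z)_\infty/(zq^k)_\infty=\prod_{i=0}^{k-1}(1-zq^i)$; $(c_1,\dots,c_p)_k=(c_1)_k\cdots(c_p)_k$ for $k$ a nonnegative integer or $\infty$. Bold letters denote multi-indices of nonnegative integers, $\boldsymbol k=(k_1,\dots,k_n)$, with $|\boldsymbol k|=k_1+\cdots+k_n$. If some $a_s=0$, the expression $\prod_{r,s}(qx_r/(x_sa_s))_{k_r}(a_1\cdots a_n)^{|\boldsymbol k|}$, which is polynomial in the $a_s$, is understood by continuity. *)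

theory Defs
  imports "HOL-Analysis.Analysis"
begin

definition qpoch :: "complex \<Rightarrow> complex \<Rightarrow> nat \<Rightarrow> complex" where
  "qpoch q z k = (\<Prod>i<k. 1 - z * q ^ i)"

definition qpoch_inf :: "complex \<Rightarrow> complex \<Rightarrow> complex" where
  "qpoch_inf q z = (\<Prod>i. 1 - z * q ^ i)"

definition qpochs :: "complex \<Rightarrow> complex list \<Rightarrow> nat \<Rightarrow> complex" where
  "qpochs q cs k = (\<Prod>c\<leftarrow>cs. qpoch q c k)"

definition qpochs_inf :: "complex \<Rightarrow> complex list \<Rightarrow> complex" where
  "qpochs_inf q cs = (\<Prod>c\<leftarrow>cs. qpoch_inf q c)"

text \<open>Parameter vectors and multi-indices are functions on \<open>nat\<close>, of which only the
  entries with index in \<open>{1..n}\<close> matter.\<close>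

definition mi_size :: "nat \<Rightarrow> (nat \<Rightarrow> nat) \<Rightarrow> nat" where
  "mi_size n k = (\<Sum>r=1..n. k r)"

definition vdm_ratio :: "complex \<Rightarrow> nat \<Rightarrow> (nat \<Rightarrow> complex) \<Rightarrow> (nat \<Rightarrow> nat) \<Rightarrow> complex" where
  "vdm_ratio q n x k =
     (\<Prod>r=1..n. \<Prod>s=r+1..n. (1 - q powi (int (k r) - int (k s)) * (x r / x s)) / (1 - x r / x s))"

definition num_factor_raw ::
  "complex \<Rightarrow> nat \<Rightarrow> (nat \<Rightarrow> complex) \<Rightarrow> (nat \<Rightarrow> nat) \<Rightarrow> (nat \<Rightarrow> complex) \<Rightarrow> complex" where
  "num_factor_raw q n x k a =
     (\<Prod>r=1..n. \<Prod>s=1..n. qpoch q (q * x r / (x s * a s)) (k r)) * (\<Prod>s=1..n. a s) ^ mi_size n k"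

text \<open>The extension of \<open>num_factor_raw\<close> by continuity to vectors \<open>a\<close> with some zero entry.
  Vectors carry the product topology, and the limit is taken along vectors all of whose
  entries with index in \<open>{1..n}\<close> are nonzero; it exists by \<open>num_factor_raw_tendsto\<close>.\<close>

definition num_factor ::
  "complex \<Rightarrow> nat \<Rightarrow> (nat \<Rightarrow> complex) \<Rightarrow> (nat \<Rightarrow> nat) \<Rightarrow> (nat \<Rightarrow> complex) \<Rightarrow> complex" where
  "num_factor q n x k a =
     (if \<forall>s\<in>{1..n}. a s \<noteq> 0 then num_factor_raw q n x k a
      else Lim (at a within {a'. \<forall>s\<in>{1..n}. a' s \<noteq> 0}) (num_factor_raw q n x k))"

definition num_factor_poly ::
  "complex \<Rightarrow> nat \<Rightarrow> (nat \<Rightarrow> complex) \<Rightarrow> (nat \<Rightarrow> nat) \<Rightarrow> (nat \<Rightarrow> complex) \<Rightarrow> complex" where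
  "num_factor_poly q n x k a =
     (\<Prod>r=1..n. \<Prod>s=1..n. \<Prod>i<k r. a s - q ^ (i + 1) * (x r / x s))"

lemma qpoch_inf_has_prod:
  assumes "norm q < 1"
  shows "(\<lambda>i. 1 - z * q ^ i) has_prod qpoch_inf q z"
proof -
  have "summable (\<lambda>i. norm ((1 - z * q ^ i) - 1))"
    using assms by (simp add: norm_mult norm_power summable_mult summable_geometric)
  then show ?thesis
    unfolding qpoch_inf_def
    by (intro convergent_prod_has_prod abs_convergent_prod_imp_convergent_prod
          summable_imp_abs_convergent_prod)
qed

lemma num_factor_raw_eq_poly:
  assumes "\<forall>s\<in>{1..n}. a s \<noteq> 0"
  shows "num_factor_raw q n x k a = num_factor_poly q n x k a"
proof -
  have "(\<Prod>s=1..n. a s) ^ mi_size n k = (\<Prod>r=1..n. \<Prod>s=1..n. a s ^ k r)"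
    by (simp add: mi_size_def power_sum prod_power_distrib)
  then have "num_factor_raw q n x k a =
      (\<Prod>r=1..n. \<Prod>s=1..n. qpoch q (q * x r / (x s * a s)) (k r) * a s ^ k r)"
    by (simp add: num_factor_raw_def prod.distrib)
  also have "\<dots> = num_factor_poly q n x k a"
    unfolding num_factor_poly_def
  proof (intro prod.cong refl)
    fix r s assume "s \<in> {1..n}"
    then have "a s \<noteq> 0" using assms by blast
    have "qpoch q (q * x r / (x s * a s)) (k r) * a s ^ k r
        = (\<Prod>i<k r. (1 - q * x r / (x s * a s) * q ^ i) * a s)"
      by (simp add: qpoch_def prod.distrib)
    also have "\<dots> = (\<Prod>i<k r. a s - q ^ (i + 1) * (x r / x s))"
      using \<open>a s \<noteq> 0\<close> by (intro prod.cong refl) (simp add: algebra_simps)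
    finally show "qpoch q (q * x r / (x s * a s)) (k r) * a s ^ k r
        = (\<Prod>i<k r. a s - q ^ (i + 1) * (x r / x s))" .
  qed
  finally show ?thesis .
qed

lemma continuous_num_factor_poly: "continuous_on UNIV (num_factor_poly q n x k)"
proof -
  have "continuous_on UNIV
      (\<lambda>a. \<Prod>r=1..n. \<Prod>s=1..n. \<Prod>i<k r. a s - q ^ (i + 1) * (x r / x s))"
    by (intro continuous_intros continuous_on_product_coordinates)
  then show ?thesis by (simp add: num_factor_poly_def[abs_def])
qed

lemma num_factor_raw_tendsto:
  "(num_factor_raw q n x k \<longlongrightarrow> num_factor_poly q n x k a)
     (at a within {a'. \<forall>s\<in>{1..n}. a' s \<noteq> 0})"
proof -
  have "(num_factor_poly q n x k \<longlongrightarrow> num_factor_poly q n x k a)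
      (at a within {a'. \<forall>s\<in>{1..n}. a' s \<noteq> 0})"
    by (rule tendsto_within_subset[OF _ subset_UNIV])
      (use continuous_num_factor_poly[of q n x k] in \<open>simp add: continuous_on_def\<close>)
  moreover have "\<forall>\<^sub>F a' in at a within {a'. \<forall>s\<in>{1..n}. a' s \<noteq> 0}.
      num_factor_poly q n x k a' = num_factor_raw q n x k a'"
    unfolding eventually_at_filter
    by (rule always_eventually) (auto simp: num_factor_raw_eq_poly)
  ultimately show ?thesis by (rule Lim_transform_eventually)
qed

lemma nonzero_vectors_limpt:
  fixes a :: "nat \<Rightarrow> complex"
  assumes "s0 \<in> {1..n}" "a s0 = 0"
  shows "at a within {a'. \<forall>s\<in>{1..n}. a' s \<noteq> 0} \<noteq> bot"
proof -
  define f where "f = (\<lambda>(j::nat) s. if a s = 0 then 1 / of_nat (Suc j) else a s)"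
  have lim: "(\<lambda>j. f j s) \<longlonglongrightarrow> a s" for s
  proof (cases "a s = 0")
    case True
    then show ?thesis
      using LIMSEQ_Suc[OF lim_const_over_n[of "1 :: complex"]] by (simp add: f_def)
  next
    case False
    then show ?thesis by (simp add: f_def)
  qed
  have "limitin (product_topology (\<lambda>_. euclidean) UNIV) f a sequentially"
    unfolding limitin_componentwise using lim by simp
  then have "f \<longlonglongrightarrow> a"
    by (simp add: euclidean_product_topology)
  moreover have "f j s \<noteq> 0" for j s
    using of_nat_neq_0[where 'a = complex, of j] by (simp add: f_def del: of_nat_Suc)
  moreover have "f j \<noteq> a" for j
    using assms(2) \<open>f j s0 \<noteq> 0\<close> by metis
  ultimately have "filterlim f (at a within {a'. \<forall>s\<in>{1..n}. a' s \<noteq> 0}) sequentially"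
    by (auto simp: filterlim_at)
  then show ?thesis
    by (metis filterlim_def le_bot filtermap_bot_iff trivial_limit_sequentially)
qed

lemma num_factor_eq_poly: "num_factor q n x k a = num_factor_poly q n x k a"
proof (cases "\<forall>s\<in>{1..n}. a s \<noteq> 0")
  case True
  then show ?thesis by (simp add: num_factor_def num_factor_raw_eq_poly)
next
  case False
  then have "at a within {a'. \<forall>s\<in>{1..n}. a' s \<noteq> 0} \<noteq> bot"
    using nonzero_vectors_limpt by blast
  then have "Lim (at a within {a'. \<forall>s\<in>{1..n}. a' s \<noteq> 0}) (num_factor_raw q n x k)
      = num_factor_poly q n x k a"
    by (intro tendsto_Lim num_factor_raw_tendsto)
  then show ?thesis using False by (auto simp: num_factor_def)
qed

end

theory Submission
  imports Defs "HOL-Complex_Analysis.Conformal_Mappings"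
begin

text \<open>
  Milne's fundamental theorem evaluates the sum over all multi-indices of a fixed size in closed
  form. Applied to the inner and to the outer sum, both of which otherwise depend on the
  multi-index through its size only, it reduces the identity to the case \<open>n = 1\<close> with
  \<open>a\<close> replaced by \<open>q Y\<close>, where \<open>Y = a\<^sub>1 \<cdots> a\<^sub>n / q ^ n\<close>.
  For \<open>Y = q ^ M\<close> that case is the inversion of a pair of triangular matrices, whose
  orthogonality is a telescoping sum. Both sides, multiplied by \<open>(\<alpha> q Y)\<^sub>\<infinity>\<close>, are
  holomorphic in \<open>Y\<close>, and the points \<open>q ^ M\<close> accumulate at \<open>0\<close>, so the identity theorem
  gives the rest. The terms of the inner sum grow like \<open>q powi - (k\<^sup>2 / 2)\<close>, so convergence rests
  on cancellation: the inner sum is a divided difference at the nodes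
  \<open>1, q, \<dots>, q ^ k\<close>, and such differences are bounded geometrically by the Leibniz rule.
\<close>

section \<open>Orthogonality in one variable\<close>

text \<open>At \<open>Y = q ^ M\<close> the factors \<open>Y - q ^ i\<close> cut the outer sum off
  at \<open>k = M\<close>, and the identity holds for an arbitrary sequence \<open>h\<close>: up to
  the factor (\<alpha> q)_M, the outer weights undo the passage from \<open>h\<close> to the inner
  sums. The special form \<open>qratio\<close> of \<open>h\<close> enters with the continuation in
  \<open>Y\<close>: the value at \<open>M\<close> must extend to a holomorphic function of
  \<open>q ^ M\<close>, and the divided differences must grow slowly. A difference of order
  \<open>l\<close> of (u)_m has size |u|^l up to a constant, one of 1/(v)_m decays faster than any
  geometric sequence, and the remaining factor (\<alpha> q^k)_m has a parameter tending to 0. So the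
  rate is max(|\<alpha> \<beta>|, |\<alpha> \<gamma>|), and rate times |Y| is below 1 by the
  conditions on \<alpha> \<beta> Y and \<alpha> \<gamma> Y. The factor (\<alpha> q Y)_inf clears the
  poles coming from the denominators (\<alpha> q Y)_k. Summing by size settles the value but not
  unconditional convergence over multi-indices, so summability is proved separately from a bound on
  each term. In the terminating case, where no bound on the parameters is available, the expansion
  at \<open>Y = q ^ M\<close> is used directly.\<close>

lemma qpoch_0 [simp]: "qpoch q z 0 = 1"
  by (simp add: qpoch_def)

lemma qpoch_Suc: "qpoch q z (Suc k) = qpoch q z k * (1 - z * q ^ k)"
  by (simp add: qpoch_def)

lemma qpoch_add: "qpoch q z (i + k) = qpoch q z i * qpoch q (z * q ^ i) k"
  by (induction k) (simp_all add: qpoch_Suc power_add mult_ac)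

lemma qpoch_Suc': "qpoch q z (Suc k) = (1 - z) * qpoch q (z * q) k"
  using qpoch_add[of q z 1 k] by (simp add: qpoch_def)

lemma qpoch_eq_0_iff: "qpoch q z k = 0 \<longleftrightarrow> (\<exists>i<k. z * q ^ i = 1)"
  by (auto simp: qpoch_def)

lemma power_neq_1:
  fixes q :: complex
  assumes "cmod q < 1" "k > 0"
  shows "q ^ k \<noteq> 1"
proof
  assume "q ^ k = 1"
  then have "cmod q ^ k = 1" by (metis norm_one norm_power)
  moreover have "cmod q ^ k < 1" using assms by (simp add: power_less_one_iff)
  ultimately show False by simp
qed

lemma qpoch_self_nonzero:
  assumes "cmod q < 1"
  shows "qpoch q q k \<noteq> 0"
  using power_neq_1[OF assms, of "Suc _"] by (auto simp: qpoch_eq_0_iff)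

lemma qpoch_powi_neg_eq_0:
  assumes "q \<noteq> 0" "k < m"
  shows "qpoch q (q powi (- int k)) m = 0"
  using assms by (auto simp: qpoch_eq_0_iff power_int_minus intro!: exI[of _ k])

lemma powi_neg_Suc:
  assumes "q \<noteq> (0::complex)"
  shows "q powi (- int (Suc k)) = q powi (- int k) / q"
  by (simp only: power_int_minus power_int_of_nat) (simp add: divide_inverse)

text \<open>A product of \<open>Suc m\<close> factors starting at
  \<open>q powi (- int (Suc k))\<close> loses either its first or its last factor. This compares the
  weights for consecutive \<open>k\<close> in the telescoping below.\<close>

lemma qpoch_powi_neg_pred:
  assumes "q \<noteq> 0"
  shows "qpoch q (q powi (- int k)) m * (1 - q powi (- int (Suc k)))
    = qpoch q (q powi (- int (Suc k))) m * (1 - q powi (int m - int (Suc k)))"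
proof -
  have e: "q powi (- int (Suc k)) * q = q powi (- int k)"
    using assms by (simp add: powi_neg_Suc del: of_nat_Suc)
  have e2: "q powi (- int (Suc k)) * q ^ m = q powi (int m - int (Suc k))"
    using assms by (simp add: power_int_diff power_int_minus divide_inverse del: of_nat_Suc)
  have "qpoch q (q powi (- int (Suc k))) (Suc m)
      = (1 - q powi (- int (Suc k))) * qpoch q (q powi (- int k)) m"
    unfolding qpoch_Suc' e ..
  moreover have "qpoch q (q powi (- int (Suc k))) (Suc m)
      = qpoch q (q powi (- int (Suc k))) m * (1 - q powi (int m - int (Suc k)))"
    unfolding qpoch_Suc e2 ..
  ultimately show ?thesis by (simp add: mult_ac)
qed

text \<open>The inner sum for \<open>n = 1\<close>. Its weights vanish for \<open>m > k\<close>, so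
  the upper limit may be raised freely.\<close>

definition qsum :: "complex \<Rightarrow> nat \<Rightarrow> (nat \<Rightarrow> complex) \<Rightarrow> complex" where
  "qsum q k f = (\<Sum>m\<le>k. qpoch q (q powi (- int k)) m / qpoch q q m * q ^ m * f m)"

lemma qsum_0 [simp]: "qsum q 0 f = f 0"
  by (simp add: qsum_def)

lemma qsum_upto:
  assumes "q \<noteq> 0" "k \<le> M"
  shows "qsum q k f = (\<Sum>m\<le>M. qpoch q (q powi (- int k)) m / qpoch q q m * q ^ m * f m)"
  unfolding qsum_def using assms
  by (intro sum.mono_neutral_left) (auto simp: qpoch_powi_neg_eq_0)

text \<open>A Pascal rule for the weights, \<open>rec\<close> in the proof. It is the recursion of
  divided differences before normalisation.\<close>

lemma qsum_Suc:
  assumes "q \<noteq> 0" "cmod q < 1"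
  shows "qsum q (Suc k) f = qsum q k f - q powi (- int k) * qsum q k (\<lambda>m. f (Suc m))"
proof -
  define c where "c = (\<lambda>k m. qpoch q (q powi (- int k)) m / qpoch q q m * q ^ m)"
  have rec: "c (Suc k) (Suc m) = c k (Suc m) - q powi (- int k) * c k m" for m
  proof -
    define u where "u = q powi (- int k)"
    have u: "q powi (- int (Suc k)) = u / q"
      using assms by (simp add: u_def powi_neg_Suc del: of_nat_Suc)
    have nz: "qpoch q q m \<noteq> 0" "1 - q * q ^ m \<noteq> 0"
      using qpoch_self_nonzero[OF assms(2)] power_neq_1[OF assms(2), of "Suc m"] by auto
    have a: "c (Suc k) (Suc m) = (1 - u / q) * qpoch q u m / (qpoch q q m * (1 - q * q ^ m)) * q ^ Suc m"
      unfolding c_def u qpoch_Suc[of q q] qpoch_Suc'[of q "u/q"] using assms by simp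
    have b: "c k (Suc m) = qpoch q u m * (1 - u * q ^ m) / (qpoch q q m * (1 - q * q ^ m)) * q ^ Suc m"
      unfolding c_def u_def qpoch_Suc ..
    have d: "c k m = qpoch q u m / qpoch q q m * q ^ m"
      unfolding c_def u_def ..
    show ?thesis using nz assms unfolding a b d u_def[symmetric]
      by (simp add: divide_simps) (simp add: algebra_simps)
  qed
  have "qsum q (Suc k) f = (\<Sum>m\<le>Suc k. c (Suc k) m * f m)"
    by (simp add: qsum_def c_def)
  also have "\<dots> = c (Suc k) 0 * f 0 + (\<Sum>m\<le>k. c (Suc k) (Suc m) * f (Suc m))"
    by (rule sum.atMost_Suc_shift)
  also have "\<dots> = c k 0 * f 0 + (\<Sum>m\<le>k. c k (Suc m) * f (Suc m))
      - q powi (- int k) * (\<Sum>m\<le>k. c k m * f (Suc m))"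
    unfolding rec by (simp add: c_def algebra_simps sum_subtractf sum_distrib_left)
  also have "c k 0 * f 0 + (\<Sum>m\<le>k. c k (Suc m) * f (Suc m)) = (\<Sum>m\<le>Suc k. c k m * f m)"
    by (rule sum.atMost_Suc_shift[symmetric])
  also have "\<dots> = qsum q k f"
    using qsum_upto[OF assms(1), of k "Suc k" f] by (simp add: c_def)
  also have "(\<Sum>m\<le>k. c k m * f (Suc m)) = qsum q k (\<lambda>m. f (Suc m))"
    by (simp add: qsum_def c_def)
  finally show ?thesis .
qed

text \<open>Evaluates the one diagonal entry that survives in the orthogonality. Pulling
  \<open>- (q ^ i)\<close> out of each factor of the first product leaves (q)_M, and these same
  powers turn the second product, times \<open>q ^ M\<close>, into (q)_M as well.\<close>

lemma qpoch_powi_neg_self: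
  assumes "q \<noteq> 0"
  shows "(\<Prod>i<M. q ^ M - q ^ i) * qpoch q (q powi (- int M)) M * q ^ M = qpoch q q M ^ 2"
proof -
  have 1: "(\<Prod>i<M. q ^ M - q ^ i) = (\<Prod>i<M. - (q ^ i)) * qpoch q q M"
  proof -
    have "(\<Prod>i<M. q ^ M - q ^ i) = (\<Prod>i<M. - (q ^ i) * (1 - q * q ^ (M - Suc i)))"
    proof (rule prod.cong)
      fix i assume "i \<in> {..<M}"
      then have "q ^ M = q ^ i * (q * q ^ (M - Suc i))"
        by (metis add_Suc_right le_add_diff_inverse lessThan_iff power_Suc power_add Suc_leI add_Suc)
      then show "q ^ M - q ^ i = - (q ^ i) * (1 - q * q ^ (M - Suc i))"
        by (simp add: algebra_simps)
    qed simp
    also have "\<dots> = (\<Prod>i<M. - (q ^ i)) * (\<Prod>i<M. 1 - q * q ^ (M - Suc i))"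
      by (rule prod.distrib)
    also have "(\<Prod>i<M. 1 - q * q ^ (M - Suc i)) = qpoch q q M"
      unfolding qpoch_def by (rule prod.nat_diff_reindex)
    finally show ?thesis .
  qed
  have 2: "(\<Prod>i<M. - (q ^ i)) * qpoch q (q powi (- int M)) M * q ^ M = qpoch q q M"
  proof (induction M)
    case (Suc M)
    have "q powi (- int (Suc M)) * q = q powi (- int M)"
      using assms by (simp add: powi_neg_Suc del: of_nat_Suc)
    then have "qpoch q (q powi (- int (Suc M))) (Suc M)
        = (1 - q powi (- int (Suc M))) * qpoch q (q powi (- int M)) M"
      by (simp add: qpoch_Suc' del: of_nat_Suc)
    moreover have "(1 - q powi (- int (Suc M))) * (- (q ^ M)) * q = 1 - q * q ^ M"
      using assms by (simp add: power_int_minus field_simps del: of_nat_Suc)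
    moreover have "(\<Prod>i<Suc M. - (q ^ i)) * ((1 - w) * X) * q ^ Suc M
       = ((\<Prod>i<M. - (q ^ i)) * X * q ^ M) * ((1 - w) * (- (q ^ M)) * q)" for w X
      by simp
    ultimately have "(\<Prod>i<Suc M. - (q ^ i)) * qpoch q (q powi (- int (Suc M))) (Suc M) * q ^ Suc M
       = ((\<Prod>i<M. - (q ^ i)) * qpoch q (q powi (- int M)) M * q ^ M) * (1 - q * q ^ M)"
      by (simp only:)
    then show ?case using Suc by (simp add: qpoch_Suc)
  qed simp
  show ?thesis unfolding 1 using 2 by (simp add: power2_eq_square mult_ac)
qed

text \<open>Each summand times \<open>q ^ M - q ^ m\<close> is the difference of two consecutive right-hand sides.\<close>

lemma orthogonality_partial_sum:
  assumes "q \<noteq> 0" "cmod q < 1" and nz: "\<And>k. qpoch q (\<alpha> * q ^ Suc M) k \<noteq> 0"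
  shows "(\<Sum>k\<le>K. (1 - \<alpha> * q ^ (2 * k)) * qpoch q \<alpha> (k + m) * qpoch q (q powi (- int k)) m
            * (\<Prod>i<k. q ^ M - q ^ i) / (qpoch q q k * qpoch q (\<alpha> * q ^ Suc M) k)) * (q ^ M - q ^ m)
    = qpoch q \<alpha> (K + m + 1) * qpoch q (q powi (- int K)) m * (\<Prod>i<Suc K. q ^ M - q ^ i)
        / (qpoch q q K * qpoch q (\<alpha> * q ^ Suc M) K)"
    (is "(\<Sum>k\<le>K. ?T k) * _ = ?U K")
proof (induction K)
  case 0
  have "qpoch q 1 m = 0" if "m > 0" using that by (auto simp: qpoch_eq_0_iff)
  then show ?case by (cases "m = 0") (simp_all add: qpoch_Suc)
next
  case (Suc K)
  define k where "k = Suc K"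
  define Q where "Q = q ^ k"
  define W where "W = qpoch q \<alpha> (k + m) * qpoch q (q powi (- int k)) m
            * (\<Prod>i<k. q ^ M - q ^ i) / (qpoch q q k * qpoch q (\<alpha> * q ^ Suc M) k)"
  have Q: "Q \<noteq> 0" "Q \<noteq> 1" "1 - \<alpha> * q ^ M * Q \<noteq> 0"
    using assms power_neq_1[OF assms(2), of k] nz[of k]
    by (auto simp: Q_def k_def qpoch_eq_0_iff mult_ac power_add)
  have T: "?T k = (1 - \<alpha> * Q ^ 2) * W"
    by (simp add: W_def Q_def power_mult mult_ac flip: power_mult)
  have U: "?U k = (1 - \<alpha> * Q * q ^ m) * (q ^ M - Q) * W"
    by (simp add: W_def Q_def qpoch_Suc power_add mult_ac)
  have "qpoch q (q powi (- int K)) m * (1 - 1 / Q) = qpoch q (q powi (- int k)) m * (1 - q ^ m / Q)"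
    using qpoch_powi_neg_pred[OF assms(1), of K m] assms(1)
    unfolding k_def[symmetric] Q_def
    by (simp add: power_int_minus power_int_diff divide_inverse)
  then have e: "qpoch q (q powi (- int K)) m * (1 - Q) = qpoch q (q powi (- int k)) m * (q ^ m - Q)"
    using Q by (simp add: field_simps)
  have "?U K = qpoch q \<alpha> (k + m) * qpoch q (q powi (- int K)) m * (\<Prod>i<k. q ^ M - q ^ i)
        / (qpoch q q K * qpoch q (\<alpha> * q ^ Suc M) K)" by (simp add: k_def)
  also have "\<dots> = qpoch q \<alpha> (k + m) * (qpoch q (q powi (- int K)) m * (1 - Q)) * (\<Prod>i<k. q ^ M - q ^ i)
        / (qpoch q q k * qpoch q (\<alpha> * q ^ Suc M) k) * (1 - \<alpha> * q ^ M * Q)"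
  proof -
    have "qpoch q q k = qpoch q q K * (1 - Q)"
      "qpoch q (\<alpha> * q ^ Suc M) k = qpoch q (\<alpha> * q ^ Suc M) K * (1 - \<alpha> * q ^ M * Q)"
      by (simp_all add: k_def Q_def qpoch_Suc mult_ac)
    then show ?thesis using Q nz[of K] qpoch_self_nonzero[OF assms(2), of K] by (simp add: divide_simps)
  qed
  also have "\<dots> = (q ^ m - Q) * (1 - \<alpha> * q ^ M * Q) * W"
    unfolding e W_def by simp
  finally have UK: "?U K = (q ^ m - Q) * (1 - \<alpha> * q ^ M * Q) * W" .
  have "(\<Sum>k\<le>Suc K. ?T k) * (q ^ M - q ^ m) = ?U K + ?T k * (q ^ M - q ^ m)"
    using Suc by (simp add: k_def distrib_right)
  \<comment> \<open>With the common factor \<open>W\<close> removed this is (q^m - Q)(1 - \<alpha>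
    q^M Q) + (1 - \<alpha> Q^2)(q^M - q^m) = (1 - \<alpha> Q q^m)(q^M - Q).\<close>
  also have "\<dots> = ?U k"
    unfolding UK T U by (simp add: algebra_simps power2_eq_square)
  finally show ?case by (simp add: k_def)
qed

text \<open>After interchanging the sums, the coefficient of \<open>h m\<close> is a partial sum
  from \<open>orthogonality_partial_sum\<close> with \<open>K = M\<close>. The product on its right
  then contains the factor \<open>q ^ M - q ^ M\<close>, which removes every \<open>m < M\<close>.
  For \<open>m = M\<close> the weights vanish unless \<open>k = M\<close>, so a single entry
  remains.\<close>

lemma terminating_expansion:
  assumes q: "q \<noteq> 0" "cmod q < 1" and \<alpha>: "\<alpha> \<noteq> 1" and nz: "\<And>k. qpoch q (\<alpha> * q ^ Suc M) k \<noteq> 0"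
  shows "(\<Sum>k\<le>M. (1 - \<alpha> * q ^ (2 * k)) * qpoch q \<alpha> k * (\<Prod>i<k. q ^ M - q ^ i)
            / ((1 - \<alpha>) * qpoch q q k * qpoch q (\<alpha> * q ^ Suc M) k)
            * qsum q k (\<lambda>m. qpoch q (\<alpha> * q ^ k) m * h m))
    = qpoch q (\<alpha> * q) M * h M"
proof -
  define T where "T = (\<lambda>m k. (1 - \<alpha> * q ^ (2 * k)) * qpoch q \<alpha> (k + m) * qpoch q (q powi (- int k)) m
            * (\<Prod>i<k. q ^ M - q ^ i) / (qpoch q q k * qpoch q (\<alpha> * q ^ Suc M) k))"
  have "(\<Sum>k\<le>M. (1 - \<alpha> * q ^ (2 * k)) * qpoch q \<alpha> k * (\<Prod>i<k. q ^ M - q ^ i)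
            / ((1 - \<alpha>) * qpoch q q k * qpoch q (\<alpha> * q ^ Suc M) k)
            * qsum q k (\<lambda>m. qpoch q (\<alpha> * q ^ k) m * h m))
     = (\<Sum>k\<le>M. \<Sum>m\<le>M. T m k * (q ^ m * h m / (qpoch q q m * (1 - \<alpha>))))"
    by (intro sum.cong refl)
       (auto simp add: qsum_upto[OF q(1), of _ M] sum_distrib_left sum_divide_distrib T_def qpoch_add mult_ac
         intro!: sum.cong)
  also have "\<dots> = (\<Sum>m\<le>M. (\<Sum>k\<le>M. T m k) * (q ^ m * h m / (qpoch q q m * (1 - \<alpha>))))"
    by (subst sum.swap) (simp only: sum_distrib_right)
  also have "\<dots> = (\<Sum>m\<in>{M}. (\<Sum>k\<le>M. T m k) * (q ^ m * h m / (qpoch q q m * (1 - \<alpha>))))"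
  proof (rule sum.mono_neutral_right)
    show "\<forall>m\<in>{..M} - {M}. (\<Sum>k\<le>M. T m k) * (q ^ m * h m / (qpoch q q m * (1 - \<alpha>))) = 0"
    proof
      fix m assume "m \<in> {..M} - {M}"
      then have m: "m < M" by auto
      have "q ^ M - q ^ m \<noteq> 0"
      proof
        assume "q ^ M - q ^ m = 0"
        moreover have "q ^ M = q ^ m * q ^ (M - m)" using m by (simp flip: power_add)
        ultimately show False using power_neq_1[OF q(2), of "M - m"] m q(1) by simp
      qed
      then show "(\<Sum>k\<le>M. T m k) * (q ^ m * h m / (qpoch q q m * (1 - \<alpha>))) = 0"
        using orthogonality_partial_sum[OF q nz, where K = M and m = m] by (simp add: T_def)
    qed
  qed auto
  also have "(\<Sum>k\<le>M. T M k) = T M M"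
  proof -
    have "(\<Sum>k\<le>M. T M k) = (\<Sum>k\<in>{M}. T M k)"
      by (rule sum.mono_neutral_right) (auto simp: T_def qpoch_powi_neg_eq_0[OF q(1)])
    then show ?thesis by simp
  qed
  then have "(\<Sum>m\<in>{M}. (\<Sum>k\<le>M. T m k) * (q ^ m * h m / (qpoch q q m * (1 - \<alpha>))))
    = T M M * (q ^ M * h M / (qpoch q q M * (1 - \<alpha>)))" by simp
  also have "\<dots> = ((1 - \<alpha> * q ^ (2 * M)) * qpoch q \<alpha> (M + M))
      * ((\<Prod>i<M. q ^ M - q ^ i) * qpoch q (q powi (- int M)) M * q ^ M) * h M
      / (qpoch q q M ^ 2 * qpoch q (\<alpha> * q ^ Suc M) M * (1 - \<alpha>))"
    by (simp add: T_def power2_eq_square mult_ac)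
  \<comment> \<open>The very-well-poised factor completes (\<alpha>)_{2M} to (\<alpha>)_{2M+1},
    which is split again so that \<open>1 - \<alpha>\<close> and the denominator cancel.\<close>
  also have "(1 - \<alpha> * q ^ (2 * M)) * qpoch q \<alpha> (M + M) = qpoch q \<alpha> (Suc (M + M))"
    by (simp add: qpoch_Suc flip: mult_2)
  also have "\<dots> = (1 - \<alpha>) * (qpoch q (\<alpha> * q) M * qpoch q (\<alpha> * q ^ Suc M) M)"
    by (simp add: qpoch_Suc' qpoch_add mult_ac)
  finally show ?thesis
    unfolding qpoch_powi_neg_self[OF q(1)]
    using \<alpha> nz[of M] qpoch_self_nonzero[OF q(2), of M] by simp
qed

section \<open>Milne's fundamental theorem\<close>

lemma prod_linear_poly:
  fixes a b :: "'b \<Rightarrow> complex"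
  assumes "finite S"
  shows "degree (\<Prod>s\<in>S. [:a s, b s:]) \<le> card S \<and> coeff (\<Prod>s\<in>S. [:a s, b s:]) (card S) = (\<Prod>s\<in>S. b s)"
  using assms
proof (induction S rule: finite_induct)
  case (insert s S)
  let ?P = "\<Prod>s\<in>S. [:a s, b s:]"
  have "degree ([:a s, b s:] * ?P) \<le> degree [:a s, b s:] + degree ?P"
    by (rule degree_mult_le)
  also have "\<dots> \<le> Suc (card S)"
    using insert by (auto simp: le_Suc_eq)
  finally have "degree ([:a s, b s:] * ?P) \<le> Suc (card S)" .
  moreover have "coeff ?P (Suc (card S)) = 0"
    using insert by (intro coeff_eq_0) auto
  ultimately show ?case using insert by simp
qed simp

text \<open>Let p(z) be the product of the \<open>a s - c s * z\<close>, and \<open>L\<close> its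
  Lagrange interpolant at the nodes \<open>w r\<close>, of smaller degree. Then p - L vanishes at
  all nodes, hence is a multiple of the product of the 1 - z / w s. Comparing leading coefficients
  gives the multiplier, and z = 0 gives the claim because every interpolation basis polynomial is
  normalised to 1 there.\<close>

lemma partial_fraction_identity:
  fixes a c w :: "'b \<Rightarrow> complex"
  assumes S: "finite S" and inj: "inj_on w S" and nz: "\<And>s. s \<in> S \<Longrightarrow> w s \<noteq> 0"
  shows "(\<Sum>r\<in>S. (\<Prod>s\<in>S. a s - c s * w r) / (\<Prod>s\<in>S - {r}. 1 - w r / w s))
    = (\<Prod>s\<in>S. a s) - (\<Prod>s\<in>S. c s * w s)"
proof -
  define p where "p = (\<Prod>s\<in>S. [:a s, - c s:])"
  define B where "B = (\<lambda>r. \<Prod>s\<in>S - {r}. [:1, - 1 / w s:])"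
  define e where "e = (\<lambda>r. poly p (w r) / (\<Prod>s\<in>S - {r}. 1 - w r / w s))"
  define L where "L = (\<Sum>r\<in>S. smult (e r) (B r))"
  define Q where "Q = smult (\<Prod>s\<in>S. c s * w s) (\<Prod>s\<in>S. [:1, - 1 / w s:])"
  have degB: "degree (B r) \<le> card S - 1" if "r \<in> S" for r
    using prod_linear_poly[of "S - {r}" "\<lambda>_. 1" "\<lambda>s. - 1 / w s"] S that by (simp add: B_def)
  have degL: "degree L < card S" if "S \<noteq> {}"
  proof -
    have "degree L \<le> card S - 1"
      unfolding L_def using degB by (intro degree_sum_le S) (meson degree_smult_le le_trans)
    then show ?thesis using that S by (metis card_gt_0_iff diff_less le_less_trans zero_less_one)
  qed
  have coeffL: "coeff L (card S) = 0"
    using degL by (cases "S = {}") (auto simp: L_def intro!: coeff_eq_0)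
  \<comment> \<open>Polynomials of degree at most \<open>card S\<close> agree once they agree at the
    \<open>card S\<close> nodes and in the coefficient of that degree.\<close>
  have "p = L + Q"
  proof (rule poly_eqI_degree_lead_coeff)
    show "coeff p (card S) = coeff (L + Q) (card S)"
    proof -
      have "coeff p (card S) = (\<Prod>s\<in>S. - c s)"
        unfolding p_def using prod_linear_poly[OF S, of a "\<lambda>s. - c s"] by blast
      also have "\<dots> = (\<Prod>s\<in>S. c s * w s) * (\<Prod>s\<in>S. - 1 / w s)"
        unfolding prod.distrib[symmetric] by (rule prod.cong) (use nz in auto)
      also have "\<dots> = coeff Q (card S)"
        unfolding Q_def using prod_linear_poly[OF S, of "\<lambda>_. 1" "\<lambda>s. - 1 / w s"] by simp
      finally show ?thesis using coeffL by simp
    qed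
    show "card (w ` S) \<ge> card S"
      using inj by (simp add: card_image)
    show "degree p \<le> card S"
      unfolding p_def using prod_linear_poly[OF S, of a "\<lambda>s. - c s"] by blast
    have "degree Q \<le> card S"
      unfolding Q_def using prod_linear_poly[OF S, of "\<lambda>_. 1" "\<lambda>s. - 1 / w s"]
      by (meson degree_smult_le le_trans)
    moreover have "degree L \<le> card S"
      using degL by (cases "S = {}") (auto simp: L_def)
    ultimately show "degree (L + Q) \<le> card S"
      by (rule degree_add_le[rotated])
    show "poly p z = poly (L + Q) z" if z: "z \<in> w ` S" for z
    proof -
      obtain r where r: "r \<in> S" "z = w r" using z by auto
      have "poly (B t) (w r) = 0" if "t \<in> S" "t \<noteq> r" for t
        using that r S nz by (auto simp: B_def poly_prod)
      then have "poly L z = e r * poly (B r) z"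
        unfolding L_def poly_sum poly_smult r(2)
        using r S by (subst sum.remove[of _ r]) (auto intro!: sum.neutral)
      also have "poly (B r) z = (\<Prod>s\<in>S - {r}. 1 - w r / w s)"
        by (simp add: B_def poly_prod r)
      also have "e r * \<dots> = poly p z"
      proof -
        have "(\<Prod>s\<in>S - {r}. 1 - w r / w s) \<noteq> 0"
          using S nz r inj by (auto simp: inj_on_def divide_simps)
        then show ?thesis by (simp add: e_def r)
      qed
      finally have "poly L z = poly p z" .
      moreover have "poly Q z = 0"
        using r S nz by (auto simp: Q_def poly_prod)
      ultimately show ?thesis by simp
    qed
  qed
  then have "poly p 0 = poly L 0 + poly Q 0" by simp
  moreover have "poly p 0 = (\<Prod>s\<in>S. a s)" by (simp add: p_def poly_prod)
  moreover have "poly Q 0 = (\<Prod>s\<in>S. c s * w s)" by (simp add: Q_def poly_prod)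
  moreover have "poly L 0 = (\<Sum>r\<in>S. e r)" by (simp add: L_def B_def poly_prod poly_sum)
  moreover have "e r = (\<Prod>s\<in>S. a s - c s * w r) / (\<Prod>s\<in>S - {r}. 1 - w r / w s)" for r
    by (simp add: e_def p_def poly_prod mult.commute)
  ultimately show ?thesis by simp
qed

lemma prod_pairs_split:
  fixes g :: "nat \<Rightarrow> nat \<Rightarrow> 'b::comm_monoid_mult"
  assumes i: "i \<in> {1..n}"
  shows "(\<Prod>r=1..n. \<Prod>s=r+1..n. g r s)
    = (\<Prod>(r, s) | r \<in> {1..n} \<and> s \<in> {r+1..n} \<and> r \<noteq> i \<and> s \<noteq> i. g r s)
      * (\<Prod>r\<in>{1..<i}. g r i) * (\<Prod>s\<in>{i+1..n}. g i s)"
proof -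
  define P where "P = {(r, s). r \<in> {1..n} \<and> s \<in> {r+1..n} \<and> r \<noteq> i \<and> s \<noteq> i}"
  define A where "A = (\<lambda>r. (r, i)) ` {1..<i}"
  define B where "B = (\<lambda>s. (i, s)) ` {i+1..n}"
  have fin: "finite P" "finite A" "finite B"
    by (rule finite_subset[of _ "{1..n} \<times> {1..n}"]) (auto simp: P_def A_def B_def)
  have disj: "P \<inter> (A \<union> B) = {}" "A \<inter> B = {}"
    by (auto simp: P_def A_def B_def)
  have eq: "(SIGMA r:{1..n}. {r+1..n}) = P \<union> (A \<union> B)"
    using i by (auto simp: P_def A_def B_def image_iff)
  have "(\<Prod>r=1..n. \<Prod>s=r+1..n. g r s) = (\<Prod>(r, s)\<in>P \<union> (A \<union> B). g r s)"
    unfolding eq[symmetric] by (rule prod.Sigma) auto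
  also have "\<dots> = (\<Prod>(r, s)\<in>P. g r s) * ((\<Prod>(r, s)\<in>A. g r s) * (\<Prod>(r, s)\<in>B. g r s))"
    by (simp only: prod.union_disjoint[OF fin(1) finite_UnI[OF fin(2,3)] disj(1)]
        prod.union_disjoint[OF fin(2,3) disj(2)])
  also have "(\<Prod>(r, s)\<in>A. g r s) = (\<Prod>r\<in>{1..<i}. g r i)"
    unfolding A_def by (subst prod.reindex) (auto simp: inj_on_def)
  also have "(\<Prod>(r, s)\<in>B. g r s) = (\<Prod>s\<in>{i+1..n}. g i s)"
    unfolding B_def by (subst prod.reindex) (auto simp: inj_on_def)
  finally show ?thesis by (simp add: P_def mult_ac)
qed

text \<open>Only pairs containing \<open>i\<close> change. For \<open>s > i\<close> their
  orientation differs from that of the one-index products, but the resulting signs are the same on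
  both sides.\<close>

lemma vandermonde_update:
  fixes y :: "nat \<Rightarrow> complex"
  assumes i: "i \<in> {1..n}"
  shows "(\<Prod>r=1..n. \<Prod>s=r+1..n. (y(i := z)) s - (y(i := z)) r) * (\<Prod>s\<in>{1..n} - {i}. y i - y s)
    = (\<Prod>r=1..n. \<Prod>s=r+1..n. y s - y r) * (\<Prod>s\<in>{1..n} - {i}. z - y s)"
proof -
  have split: "(\<Prod>s\<in>{1..n} - {i}. f s) = (\<Prod>r\<in>{1..<i}. f r) * (\<Prod>s\<in>{i+1..n}. f s)"
    for f :: "nat \<Rightarrow> complex"
  proof -
    have e: "{1..n} - {i} = {1..<i} \<union> {i+1..n}" using i by auto
    show ?thesis unfolding e by (rule prod.union_disjoint) auto
  qed
  define R where "R = (\<Prod>(r, s) | r \<in> {1..n} \<and> s \<in> {r+1..n} \<and> r \<noteq> i \<and> s \<noteq> i. y s - y r)"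
  have R: "(\<Prod>(r, s) | r \<in> {1..n} \<and> s \<in> {r+1..n} \<and> r \<noteq> i \<and> s \<noteq> i.
      (y(i := z)) s - (y(i := z)) r) = R"
    unfolding R_def by (rule prod.cong) auto
  have 1: "(\<Prod>r\<in>{1..<i}. (y(i := z)) i - (y(i := z)) r) = (\<Prod>r\<in>{1..<i}. z - y r)"
    by (rule prod.cong) auto
  have 2: "(\<Prod>s\<in>{i+1..n}. (y(i := z)) s - (y(i := z)) i) = (\<Prod>s\<in>{i+1..n}. y s - z)"
    by (rule prod.cong) auto
  have 3: "(\<Prod>s\<in>{i+1..n}. y s - z) * (\<Prod>s\<in>{i+1..n}. y i - y s)
      = (\<Prod>s\<in>{i+1..n}. y s - y i) * (\<Prod>s\<in>{i+1..n}. z - y s)"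
    unfolding prod.distrib[symmetric] by (rule prod.cong) (auto simp: algebra_simps)
  have "(R * (\<Prod>r\<in>{1..<i}. z - y r) * (\<Prod>s\<in>{i+1..n}. y s - z))
      * ((\<Prod>r\<in>{1..<i}. y i - y r) * (\<Prod>s\<in>{i+1..n}. y i - y s))
    = (R * (\<Prod>r\<in>{1..<i}. y i - y r)) * (\<Prod>r\<in>{1..<i}. z - y r)
      * ((\<Prod>s\<in>{i+1..n}. y s - z) * (\<Prod>s\<in>{i+1..n}. y i - y s))"
    by (simp only: mult_ac)
  also have "\<dots> = (R * (\<Prod>r\<in>{1..<i}. y i - y r) * (\<Prod>s\<in>{i+1..n}. y s - y i))
      * ((\<Prod>r\<in>{1..<i}. z - y r) * (\<Prod>s\<in>{i+1..n}. z - y s))"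
    unfolding 3 by (simp only: mult_ac)
  finally have fin: "(R * (\<Prod>r\<in>{1..<i}. z - y r) * (\<Prod>s\<in>{i+1..n}. y s - z))
      * ((\<Prod>r\<in>{1..<i}. y i - y r) * (\<Prod>s\<in>{i+1..n}. y i - y s))
    = (R * (\<Prod>r\<in>{1..<i}. y i - y r) * (\<Prod>s\<in>{i+1..n}. y s - y i))
      * ((\<Prod>r\<in>{1..<i}. z - y r) * (\<Prod>s\<in>{i+1..n}. z - y s))" .
  have V': "(\<Prod>r=1..n. \<Prod>s=r+1..n. (y(i := z)) s - (y(i := z)) r)
      = R * (\<Prod>r\<in>{1..<i}. z - y r) * (\<Prod>s\<in>{i+1..n}. y s - z)"
    by (rule trans[OF prod_pairs_split[OF i]]) (simp only: R 1 2)
  have V: "(\<Prod>r=1..n. \<Prod>s=r+1..n. y s - y r)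
      = R * (\<Prod>r\<in>{1..<i}. y i - y r) * (\<Prod>s\<in>{i+1..n}. y s - y i)"
    by (rule trans[OF prod_pairs_split[OF i]]) (simp only: R_def)
  show ?thesis unfolding V V' split by (rule fin)
qed

text \<open>Extensional functions, so that each tuple is represented exactly once and the sets are
  finite.\<close>

definition multi_indices :: "nat \<Rightarrow> nat \<Rightarrow> (nat \<Rightarrow> nat) set" where
  "multi_indices n K = {k \<in> {1..n} \<rightarrow>\<^sub>E UNIV. mi_size n k = K}"

lemma multi_index_le:
  assumes "r \<in> {1..n}"
  shows "k r \<le> mi_size n k"
  unfolding mi_size_def using assms by (intro member_le_sum) auto

lemma finite_multi_indices: "finite (multi_indices n K)"
proof (rule finite_subset)
  show "multi_indices n K \<subseteq> {1..n} \<rightarrow>\<^sub>E {..K}"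
  proof
    fix k assume "k \<in> multi_indices n K"
    then have "k \<in> extensional {1..n}" "mi_size n k = K"
      by (simp_all add: multi_indices_def PiE_iff)
    then show "k \<in> {1..n} \<rightarrow>\<^sub>E {..K}"
      using multi_index_le[of _ n k] by (simp add: PiE_iff)
  qed
qed (auto intro: finite_PiE)

lemma multi_indices_0: "multi_indices n 0 = {\<lambda>r\<in>{1..n}. 0}"
proof (intro equalityI subsetI)
  fix k assume k: "k \<in> multi_indices n 0"
  show "k \<in> {\<lambda>r\<in>{1..n}. 0}"
  proof -
    have "k \<in> extensional {1..n}" "\<forall>r\<in>{1..n}. k r = 0"
      using multi_index_le[of _ n k] k by (simp_all add: multi_indices_def PiE_iff)
    then have "k = (\<lambda>r\<in>{1..n}. 0)" by (auto simp: extensional_def)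
    then show ?thesis by simp
  qed
qed (auto simp: multi_indices_def mi_size_def)

lemma mi_size_upd:
  assumes "r \<in> {1..n}"
  shows "mi_size n (k(r := Suc (k r))) = Suc (mi_size n k)"
proof -
  have "mi_size n (k(r := Suc (k r))) = Suc (k r) + (\<Sum>s\<in>{1..n} - {r}. k s)"
    unfolding mi_size_def using assms by (subst sum.remove[of _ r]) auto
  moreover have "mi_size n k = k r + (\<Sum>s\<in>{1..n} - {r}. k s)"
    unfolding mi_size_def using assms by (subst sum.remove[of _ r]) auto
  ultimately show ?thesis by simp
qed

lemma multi_indices_Suc_image:
  assumes "r \<in> {1..n}"
  shows "{k \<in> multi_indices n (Suc K). k r > 0} = (\<lambda>k. k(r := Suc (k r))) ` multi_indices n K"
proof (intro equalityI subsetI)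
  fix k assume k: "k \<in> {k \<in> multi_indices n (Suc K). k r > 0}"
  define l where "l = k(r := k r - 1)"
  have kl: "k = l(r := Suc (l r))" using k by (auto simp: l_def)
  have "l \<in> multi_indices n K"
    using k mi_size_upd[OF assms, of l] assms unfolding kl[symmetric]
    by (auto simp: multi_indices_def l_def PiE_iff extensional_def)
  then show "k \<in> (\<lambda>k. k(r := Suc (k r))) ` multi_indices n K" using kl by blast
next
  fix k assume "k \<in> (\<lambda>k. k(r := Suc (k r))) ` multi_indices n K"
  then obtain l where l: "k = l(r := Suc (l r))" "l \<in> multi_indices n K" by blast
  then show "k \<in> {k \<in> multi_indices n (Suc K). k r > 0}"
    using mi_size_upd[OF assms, of l] assms
    by (auto simp: multi_indices_def PiE_iff extensional_def)
qed

text \<open>Numerators are kept in the form \<open>a s - c s * x r * q ^ i\<close>, without dividing by \<open>a s\<close>, so that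
  vanishing \<open>a s\<close> need no separate treatment.\<close>

definition milne_term :: "complex \<Rightarrow> nat \<Rightarrow> (nat \<Rightarrow> complex) \<Rightarrow> (nat \<Rightarrow> complex) \<Rightarrow> (nat \<Rightarrow> complex)
    \<Rightarrow> (nat \<Rightarrow> nat) \<Rightarrow> complex" where
  "milne_term q n x a c k =
     (\<Prod>r=1..n. \<Prod>s=r+1..n. (x s * q ^ k s - x r * q ^ k r)) / (\<Prod>r=1..n. \<Prod>s=r+1..n. (x s - x r))
     * (\<Prod>r=1..n. \<Prod>s=1..n. (\<Prod>i<k r. a s - c s * x r * q ^ i) / qpoch q (q * x r / x s) (k r))"

section \<open>Milne's theorem by recursion in the size of the multi-index\<close>

context
  fixes q :: complex and n :: nat and x :: "nat \<Rightarrow> complex"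
  assumes q: "q \<noteq> 0" "cmod q < 1"
    and x_nz: "\<And>s. s \<in> {1..n} \<Longrightarrow> x s \<noteq> 0"
    and x_distinct: "\<And>r s. 1 \<le> r \<Longrightarrow> r < s \<Longrightarrow> s \<le> n \<Longrightarrow> 1 - x r / x s \<noteq> 0"
    and qx_nz: "\<And>r s K. r \<in> {1..n} \<Longrightarrow> s \<in> {1..n} \<Longrightarrow> qpoch q (q * x r / x s) K \<noteq> 0"
begin

text \<open>An equality with \<open>i < j\<close> would make the factor of index
  \<open>j - Suc i\<close> in (q x_s / x_r) vanish, and one with \<open>i = j\<close> would give
  \<open>x r = x s\<close>. The points \<open>x s * q ^ k s\<close> can therefore serve as nodes for
  partial fractions.\<close>

lemma shifted_distinct:
  assumes "r \<in> {1..n}" "s \<in> {1..n}" "r \<noteq> s"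
  shows "x r * q ^ i \<noteq> x s * q ^ j"
proof -
  have aux: False if rs: "r \<in> {1..n}" "s \<in> {1..n}" "i < j" "x r * q ^ i = x s * q ^ j" for r s i j
  proof -
    have qj: "q ^ j = q ^ (j - Suc i) * q ^ Suc i"
      using rs(3) by (simp only: power_add[symmetric]) simp
    have e: "x r * q ^ i = (x s * q * q ^ (j - Suc i)) * q ^ i"
      unfolding rs(4) qj by simp
    have "q ^ i \<noteq> 0" using q(1) by simp
    from mult_right_cancel[OF this, THEN iffD1, OF e]
    have "x r = x s * q * q ^ (j - Suc i)" .
    then have "q * x s / x r * q ^ (j - Suc i) = 1"
      using x_nz[OF rs(1)] x_nz[OF rs(2)] q(1) by simp
    then have "qpoch q (q * x s / x r) (j - i) = 0"
      using rs(3) by (auto simp: qpoch_eq_0_iff intro!: exI[of _ "j - Suc i"])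
    then show False using qx_nz[OF rs(2,1)] by blast
  qed
  have ne: "x r \<noteq> x s"
    using x_distinct[of r s] x_distinct[of s r] assms x_nz by (cases r s rule: linorder_cases) auto
  show ?thesis
    using aux[OF assms(1,2), of i j] aux[OF assms(2,1), of j i] ne q(1)
    by (cases i j rule: linorder_cases) auto
qed

text \<open>Raising \<open>k r\<close> replaces the node \<open>y r\<close> by
  \<open>q * y r\<close> in the Vandermonde product and appends one factor for each
  \<open>s\<close>. The quotients on the two sides are exactly \<open>r\<close>-th partial fraction
  summands: on the left for numerators \<open>1 - z / x s\<close> at the raised index, on the right
  for \<open>a s - c s * z\<close> at \<open>k\<close>.\<close>

lemma milne_term_step:
  fixes k :: "nat \<Rightarrow> nat"
  assumes r: "r \<in> {1..n}"
  defines "y \<equiv> \<lambda>s. x s * q ^ k s"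
  shows "milne_term q n x a c (k(r := Suc (k r)))
      * ((\<Prod>s=1..n. 1 - 1 / x s * (q * y r)) / (\<Prod>s\<in>{1..n} - {r}. 1 - q * y r / y s))
    = milne_term q n x a c k * ((\<Prod>s=1..n. a s - c s * y r) / (\<Prod>s\<in>{1..n} - {r}. 1 - y r / y s))"
proof -
  let ?k = "k(r := Suc (k r))"
  have y_nz: "y s \<noteq> 0" if "s \<in> {1..n}" for s
    using x_nz[OF that] q by (simp add: y_def)
  have dist: "y r \<noteq> y s" "q * y r \<noteq> y s" if "s \<in> {1..n} - {r}" for s
    using shifted_distinct[of r s "k r" "k s"] shifted_distinct[of r s "Suc (k r)" "k s"] that r
    by (auto simp: y_def mult_ac)
  define V where "V = (\<Prod>i=1..n. \<Prod>j=i+1..n. y j - y i)"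
  define V' where "V' = (\<Prod>i=1..n. \<Prod>j=i+1..n. x j * q ^ ?k j - x i * q ^ ?k i)"
  define X where "X = (\<Prod>i=1..n. \<Prod>j=i+1..n. x j - x i)"
  define D where "D = (\<lambda>k i. \<Prod>s=1..n. (\<Prod>j<(k i :: nat). a s - c s * x i * q ^ j) / qpoch q (q * x i / x s) (k i))"
  define N where "N = (\<Prod>s=1..n. 1 - 1 / x s * (q * y r))"
  \<comment> \<open>The factors of \<open>N\<close> are the last factors of
    \<open>qpoch q (q * x r / x s) (Suc (k r))\<close>.\<close>
  have N_nz: "N \<noteq> 0"
  proof -
    have "1 - 1 / x s * (q * y r) \<noteq> 0" if "s \<in> {1..n}" for s
      using qx_nz[OF r that, of "Suc (k r)"] by (auto simp: y_def qpoch_Suc mult_ac)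
    then show ?thesis by (simp add: N_def)
  qed
  have y': "(\<lambda>s. x s * q ^ ?k s) = y(r := q * y r)"
    by (auto simp: y_def)
  have V': "V' * (\<Prod>s\<in>{1..n} - {r}. y r - y s) = V * (\<Prod>s\<in>{1..n} - {r}. q * y r - y s)"
    using vandermonde_update[OF r, of y "q * y r"] unfolding y'[symmetric] V'_def V_def .
  have conv: "(\<Prod>s\<in>{1..n} - {r}. 1 - z / y s) = (\<Prod>s\<in>{1..n} - {r}. z - y s) / (\<Prod>s\<in>{1..n} - {r}. - y s)" for z
    unfolding prod_dividef[symmetric] by (rule prod.cong) (use y_nz in \<open>auto simp: field_simps\<close>)
  have nz1: "(\<Prod>s\<in>{1..n} - {r}. - y s) \<noteq> 0" using y_nz by auto
  have nz2: "(\<Prod>s\<in>{1..n} - {r}. y r - y s) \<noteq> 0" using dist(1) by (subst prod_zero_iff) auto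
  have nz3: "(\<Prod>s\<in>{1..n} - {r}. q * y r - y s) \<noteq> 0" using dist(2) by (subst prod_zero_iff) auto
  have V'': "V' / (\<Prod>s\<in>{1..n} - {r}. 1 - q * y r / y s) = V / (\<Prod>s\<in>{1..n} - {r}. 1 - y r / y s)"
  proof -
    have "V' / (p / m) = V / (o' / m)" if "V' * o' = V * p" "m \<noteq> 0" "o' \<noteq> 0" "p \<noteq> 0" for p o' m :: complex
      using that by (simp add: field_simps)
    from this[OF V' nz1 nz2 nz3] show ?thesis unfolding conv .
  qed
  have Dr: "D ?k r * N = D k r * (\<Prod>s=1..n. a s - c s * y r)"
  proof -
    have "D ?k r = (\<Prod>s=1..n. (\<Prod>j<k r. a s - c s * x r * q ^ j) / qpoch q (q * x r / x s) (k r)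
        * ((a s - c s * y r) / (1 - 1 / x s * (q * y r))))"
      unfolding D_def by (rule prod.cong) (auto simp: qpoch_Suc y_def mult_ac)
    also have "\<dots> = D k r * ((\<Prod>s=1..n. a s - c s * y r) / N)"
      unfolding prod.distrib prod_dividef[symmetric] D_def N_def by simp
    finally show ?thesis using N_nz by simp
  qed
  have Dprod: "(\<Prod>i=1..n. D k' i) = D k' r * (\<Prod>i\<in>{1..n} - {r}. D k' i)" for k'
    using r by (intro prod.remove) auto
  have "(\<Prod>i\<in>{1..n} - {r}. D ?k i) = (\<Prod>i\<in>{1..n} - {r}. D k i)"
    by (rule prod.cong) (auto simp: D_def)
  then have DD: "(\<Prod>i=1..n. D ?k i) * N = (\<Prod>i=1..n. D k i) * (\<Prod>s=1..n. a s - c s * y r)"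
    unfolding Dprod using Dr by (simp add: mult_ac)
  have m': "milne_term q n x a c ?k = V' / X * (\<Prod>i=1..n. D ?k i)"
    unfolding milne_term_def V'_def X_def D_def ..
  have m: "milne_term q n x a c k = V / X * (\<Prod>i=1..n. D k i)"
    unfolding milne_term_def V_def X_def D_def y_def ..
  have "milne_term q n x a c ?k * (N / (\<Prod>s\<in>{1..n} - {r}. 1 - q * y r / y s))
    = V' / (\<Prod>s\<in>{1..n} - {r}. 1 - q * y r / y s) / X * ((\<Prod>i=1..n. D ?k i) * N)"
    unfolding m' by (simp add: mult_ac)
  also have "\<dots> = milne_term q n x a c k
      * ((\<Prod>s=1..n. a s - c s * y r) / (\<Prod>s\<in>{1..n} - {r}. 1 - y r / y s))"
    unfolding V'' DD m by (simp add: mult_ac)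
  finally show ?thesis unfolding N_def .
qed

text \<open>The partial fraction identity is used twice: with \<open>a = 1\<close>, \<open>c s = 1 / x s\<close> it splits
  \<open>1 - q ^ Suc K\<close> over the coordinates of a multi-index of size \<open>Suc K\<close>, and after lowering
  that coordinate by one it resums to the factor on the right.\<close>

lemma milne_sum_Suc:
  "(\<Sum>k\<in>multi_indices n (Suc K). milne_term q n x a c k) * (1 - q ^ Suc K)
    = (\<Sum>k\<in>multi_indices n K. milne_term q n x a c k) * ((\<Prod>s=1..n. a s) - (\<Prod>s=1..n. c s * x s) * q ^ K)"
proof -
  define y where "y = (\<lambda>k s. x s * q ^ k s)"
  define C where "C = (\<lambda>k r. (\<Prod>s=1..n. 1 - 1 / x s * y k r) / (\<Prod>s\<in>{1..n} - {r}. 1 - y k r / y k s))"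
  have inj: "inj_on (y k) {1..n}" for k
    using shifted_distinct unfolding y_def inj_on_def by metis
  have nz: "y k s \<noteq> 0" if "s \<in> {1..n}" for k s
    using x_nz[OF that] q by (simp add: y_def)
  have qk: "(\<Prod>s=1..n. q ^ k s) = q ^ mi_size n k" for k
    by (simp only: mi_size_def power_sum)
  have sumC: "(\<Sum>r=1..n. C k r) = 1 - q ^ mi_size n k" for k
  proof -
    have "(\<Sum>r=1..n. C k r) = (\<Prod>s=1..n. 1) - (\<Prod>s=1..n. 1 / x s * y k s)"
      unfolding C_def by (rule partial_fraction_identity[OF _ inj nz]) auto
    also have "(\<Prod>s=1..n. 1 / x s * y k s) = (\<Prod>s=1..n. q ^ k s)"
      by (rule prod.cong) (use x_nz in \<open>auto simp: y_def\<close>)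
    finally show ?thesis unfolding qk by simp
  qed
  \<comment> \<open>The numerator factor for \<open>s = r\<close> is \<open>1 - q ^ k r\<close>.
    Indices whose coordinate \<open>r\<close> cannot be lowered thus contribute nothing, and
    lowering is a bijection on the rest.\<close>
  have C0: "C k r = 0" if "r \<in> {1..n}" "k r = 0" for k r
    using that x_nz[OF that(1)] by (auto simp: C_def y_def)
  have "(\<Sum>k\<in>multi_indices n (Suc K). milne_term q n x a c k) * (1 - q ^ Suc K)
      = (\<Sum>k\<in>multi_indices n (Suc K). \<Sum>r=1..n. milne_term q n x a c k * C k r)"
    unfolding sum_distrib_right sum_distrib_left[symmetric] sumC
    by (rule sum.cong) (auto simp: multi_indices_def)
  also have "\<dots> = (\<Sum>r=1..n. \<Sum>k\<in>multi_indices n (Suc K). milne_term q n x a c k * C k r)"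
    by (rule sum.swap)
  also have "\<dots> = (\<Sum>r=1..n. \<Sum>k\<in>multi_indices n K. milne_term q n x a c k
      * ((\<Prod>s=1..n. a s - c s * y k r) / (\<Prod>s\<in>{1..n} - {r}. 1 - y k r / y k s)))"
  proof (rule sum.cong)
    fix r assume r: "r \<in> {1..n}"
    have "(\<Sum>k\<in>multi_indices n (Suc K). milne_term q n x a c k * C k r)
        = (\<Sum>k\<in>{k \<in> multi_indices n (Suc K). k r > 0}. milne_term q n x a c k * C k r)"
      by (rule sum.mono_neutral_right) (use C0[OF r] finite_multi_indices in auto)
    also have "\<dots> = (\<Sum>k\<in>multi_indices n K. milne_term q n x a c (k(r := Suc (k r))) * C (k(r := Suc (k r))) r)"
      unfolding multi_indices_Suc_image[OF r]
    proof (subst sum.reindex)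
      show "inj_on (\<lambda>k. k(r := Suc (k r))) (multi_indices n K)"
      proof (rule inj_onI)
        fix k l :: "nat \<Rightarrow> nat" assume e: "k(r := Suc (k r)) = l(r := Suc (l r))"
        show "k = l"
        proof
          fix s show "k s = l s" using fun_cong[OF e, of s] by (cases "s = r") auto
        qed
      qed
    qed simp
    also have "\<dots> = (\<Sum>k\<in>multi_indices n K. milne_term q n x a c k
      * ((\<Prod>s=1..n. a s - c s * y k r) / (\<Prod>s\<in>{1..n} - {r}. 1 - y k r / y k s)))"
    proof (rule sum.cong)
      fix k
      have yr: "y (k(r := Suc (k r))) r = q * y k r" by (simp add: y_def)
      have "(\<Prod>s\<in>{1..n} - {r}. 1 - q * y k r / y (k(r := Suc (k r))) s)
         = (\<Prod>s\<in>{1..n} - {r}. 1 - q * y k r / y k s)"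
        by (rule prod.cong) (auto simp: y_def)
      then have "C (k(r := Suc (k r))) r
         = (\<Prod>s=1..n. 1 - 1 / x s * (q * y k r)) / (\<Prod>s\<in>{1..n} - {r}. 1 - q * y k r / y k s)"
        unfolding C_def yr by simp
      then show "milne_term q n x a c (k(r := Suc (k r))) * C (k(r := Suc (k r))) r
        = milne_term q n x a c k
      * ((\<Prod>s=1..n. a s - c s * y k r) / (\<Prod>s\<in>{1..n} - {r}. 1 - y k r / y k s))"
        using milne_term_step[OF r, of a c k] unfolding y_def by simp
    qed simp
    finally show "(\<Sum>k\<in>multi_indices n (Suc K). milne_term q n x a c k * C k r) = \<dots>" .
  qed simp
  also have "\<dots> = (\<Sum>k\<in>multi_indices n K. milne_term q n x a c k
      * (\<Sum>r=1..n. (\<Prod>s=1..n. a s - c s * y k r) / (\<Prod>s\<in>{1..n} - {r}. 1 - y k r / y k s)))"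
    by (subst sum.swap) (simp only: sum_distrib_left)
  also have "\<dots> = (\<Sum>k\<in>multi_indices n K. milne_term q n x a c k
      * ((\<Prod>s=1..n. a s) - (\<Prod>s=1..n. c s * x s) * q ^ K))"
  proof (rule sum.cong)
    fix k assume k: "k \<in> multi_indices n K"
    have "(\<Sum>r=1..n. (\<Prod>s=1..n. a s - c s * y k r) / (\<Prod>s\<in>{1..n} - {r}. 1 - y k r / y k s))
      = (\<Prod>s=1..n. a s) - (\<Prod>s=1..n. c s * y k s)"
      by (rule partial_fraction_identity[OF _ inj nz]) auto
    also have "(\<Prod>s=1..n. c s * y k s) = (\<Prod>s=1..n. c s * x s) * (\<Prod>s=1..n. q ^ k s)"
      by (simp add: y_def prod.distrib mult_ac)
    finally show "milne_term q n x a c k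
      * (\<Sum>r=1..n. (\<Prod>s=1..n. a s - c s * y k r) / (\<Prod>s\<in>{1..n} - {r}. 1 - y k r / y k s))
      = milne_term q n x a c k * ((\<Prod>s=1..n. a s) - (\<Prod>s=1..n. c s * x s) * q ^ K)"
      using k unfolding qk by (simp add: multi_indices_def)
  qed simp
  finally show ?thesis by (simp only: sum_distrib_right)
qed

text \<open>For \<open>n = 1\<close> both sides are the same single term. In general the gain is
  that the right side depends on \<open>a\<close> and \<open>c\<close> only through two products,
  which is what collapses the multiple sums to one variable.\<close>

lemma milne_fundamental:
  "(\<Sum>k\<in>multi_indices n K. milne_term q n x a c k)
    = (\<Prod>i<K. (\<Prod>s=1..n. a s) - (\<Prod>s=1..n. c s * x s) * q ^ i) / qpoch q q K"
proof (induction K)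
  case 0
  have "x s \<noteq> x r" if "r \<in> {1..n}" "s \<in> {r+1..n}" for r s
    using shifted_distinct[of s r 0 0] that by auto
  then have "(\<Prod>r=1..n. \<Prod>s=r+1..n. x s - x r) \<noteq> 0" by simp
  moreover have "(\<Prod>r=1..n. \<Prod>s=r+1..n. x s * q ^ (\<lambda>r\<in>{1..n}. 0) s - x r * q ^ (\<lambda>r\<in>{1..n}. 0) r)
     = (\<Prod>r=1..n. \<Prod>s=r+1..n. x s - x r)"
    by (intro prod.cong) auto
  ultimately show ?case
    by (simp add: multi_indices_0 milne_term_def)
next
  case (Suc K)
  have "1 - q ^ Suc K \<noteq> 0" using power_neq_1[OF q(2), of "Suc K"] by simp
  then have "(\<Sum>k\<in>multi_indices n (Suc K). milne_term q n x a c k)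
      = (\<Prod>i<K. (\<Prod>s=1..n. a s) - (\<Prod>s=1..n. c s * x s) * q ^ i) / qpoch q q K
        * ((\<Prod>s=1..n. a s) - (\<Prod>s=1..n. c s * x s) * q ^ K) / (1 - q ^ Suc K)"
    using milne_sum_Suc[of a c K] unfolding Suc by (simp only: eq_divide_eq) simp
  then show ?case by (simp add: qpoch_Suc)
qed

end

section \<open>Infinite products and divided differences\<close>

lemma qpoch_tendsto_inf:
  assumes "cmod q < 1"
  shows "(\<lambda>k. qpoch q z k) \<longlonglongrightarrow> qpoch_inf q z"
  unfolding qpoch_def by (rule has_prod_imp_tendsto'[OF qpoch_inf_has_prod[OF assms]])

lemma qpoch_inf_split:
  assumes "cmod q < 1"
  shows "qpoch_inf q z = qpoch q z k * qpoch_inf q (z * q ^ k)"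
proof (rule LIMSEQ_unique)
  show "(\<lambda>i. qpoch q z (i + k)) \<longlonglongrightarrow> qpoch_inf q z"
    using qpoch_tendsto_inf[OF assms] by (rule LIMSEQ_ignore_initial_segment)
  have "(\<lambda>i. qpoch q z k * qpoch q (z * q ^ k) i) \<longlonglongrightarrow> qpoch q z k * qpoch_inf q (z * q ^ k)"
    by (intro tendsto_intros qpoch_tendsto_inf assms)
  then show "(\<lambda>i. qpoch q z (i + k)) \<longlonglongrightarrow> qpoch q z k * qpoch_inf q (z * q ^ k)"
    by (simp add: add.commute[of _ k] qpoch_add)
qed

lemma qpoch_inf_nonzero_iff:
  assumes "cmod q < 1"
  shows "qpoch_inf q z \<noteq> 0 \<longleftrightarrow> (\<forall>k. qpoch q z k \<noteq> 0)"
proof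
  assume "qpoch_inf q z \<noteq> 0"
  then show "\<forall>k. qpoch q z k \<noteq> 0"
    using qpoch_inf_split[OF assms] by (metis mult_zero_left)
next
  assume *: "\<forall>k. qpoch q z k \<noteq> 0"
  have "1 - z * q ^ i \<noteq> 0" for i
    using *[rule_format, of "Suc i"] by (simp add: qpoch_Suc)
  then show "qpoch_inf q z \<noteq> 0"
    unfolding qpoch_inf_def using qpoch_inf_has_prod[OF assms, of z]
    by (intro prodinf_nonzero) (auto simp: has_prod_iff)
qed

lemma qpoch_inf_nonzero:
  assumes "cmod q < 1" "cmod z < 1"
  shows "qpoch_inf q z \<noteq> 0"
proof -
  have "z * q ^ i \<noteq> 1" for i
  proof
    assume "z * q ^ i = 1"
    then have "cmod z * cmod q ^ i = 1" by (metis norm_mult norm_power norm_one)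
    moreover have "cmod z * cmod q ^ i \<le> cmod z * 1"
      using assms by (intro mult_left_mono power_le_one) auto
    ultimately show False using assms by simp
  qed
  then show ?thesis by (simp add: qpoch_inf_nonzero_iff[OF assms(1)] qpoch_eq_0_iff)
qed

text \<open>Each factor is at most \<sigma> (1 + (U / \<sigma>) |q|^i), and the product of the
  brackets is at most the exponential of a geometric series. The base is some \<sigma> > 0 above |a|
  rather than |a| itself, so that \<open>a = 0\<close> is covered, and the constant is uniform in
  \<open>a\<close>, \<open>u\<close> and \<open>k\<close>.\<close>

lemma norm_shifted_prod_bound:
  assumes q: "cmod q < 1" and "0 < \<sigma>" "0 \<le> U"
  obtains C where "C > 0" "\<And>a u k. cmod a \<le> \<sigma> \<Longrightarrow> cmod u \<le> U \<Longrightarrow> cmod (\<Prod>i<k. a - u * q ^ i) \<le> C * \<sigma> ^ k"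
proof
  define S where "S = U / \<sigma> * (1 / (1 - cmod q))"
  show "exp S > 0" by simp
  fix a u k assume a: "cmod a \<le> \<sigma>" and u: "cmod u \<le> U"
  have "cmod (\<Prod>i<k. a - u * q ^ i) = (\<Prod>i<k. cmod (a - u * q ^ i))"
    by (simp add: prod_norm)
  also have "\<dots> \<le> (\<Prod>i<k. \<sigma> * (1 + U / \<sigma> * cmod q ^ i))"
  proof (rule prod_mono)
    fix i
    have "cmod (a - u * q ^ i) \<le> cmod a + cmod u * cmod q ^ i"
      using norm_triangle_ineq4[of a "u * q ^ i"] by (simp add: norm_mult norm_power)
    also have "\<dots> \<le> \<sigma> + U * cmod q ^ i"
      using a u by (intro add_mono mult_right_mono) auto
    also have "\<dots> = \<sigma> * (1 + U / \<sigma> * cmod q ^ i)"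
      using assms by (simp add: field_simps)
    finally show "0 \<le> cmod (a - u * q ^ i) \<and> cmod (a - u * q ^ i) \<le> \<sigma> * (1 + U / \<sigma> * cmod q ^ i)"
      by simp
  qed
  also have "\<dots> = \<sigma> ^ k * (\<Prod>i<k. 1 + U / \<sigma> * cmod q ^ i)"
    by (simp add: prod.distrib)
  also have "\<dots> \<le> \<sigma> ^ k * exp (\<Sum>i<k. U / \<sigma> * cmod q ^ i)"
    using assms by (intro mult_left_mono prod_le_exp_sum) auto
  also have "\<dots> \<le> \<sigma> ^ k * exp S"
  proof -
    have "(\<Sum>i<k. cmod q ^ i) \<le> (\<Sum>i. cmod q ^ i)"
      using q by (intro sum_le_suminf summable_geometric) auto
    also have "\<dots> = 1 / (1 - cmod q)"
      using q by (intro suminf_geometric) auto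
    finally have "(\<Sum>i<k. U / \<sigma> * cmod q ^ i) \<le> S"
      unfolding S_def sum_distrib_left[symmetric] using assms by (intro mult_left_mono) auto
    then show ?thesis using assms by (intro mult_left_mono) auto
  qed
  finally show "cmod (\<Prod>i<k. a - u * q ^ i) \<le> exp S * \<sigma> ^ k" by (simp add: mult.commute)
qed

lemma qpoch_bound:
  assumes q: "cmod q < 1" and "0 \<le> U"
  obtains C where "C > 0" "\<And>u k. cmod u \<le> U \<Longrightarrow> cmod (qpoch q u k) \<le> C"
  using norm_shifted_prod_bound[OF q, of 1 U] assms
  by (metis norm_one order_refl power_one mult_1_right qpoch_def zero_less_one)

lemma qpoch_inf_bound:
  assumes q: "cmod q < 1" and "0 \<le> U"
  obtains C where "C > 0" "\<And>u. cmod u \<le> U \<Longrightarrow> cmod (qpoch_inf q u) \<le> C"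
proof -
  obtain C where C: "C > 0" "\<And>u k. cmod u \<le> U \<Longrightarrow> cmod (qpoch q u k) \<le> C"
    using qpoch_bound[OF assms] by blast
  have "cmod (qpoch_inf q u) \<le> C" if "cmod u \<le> U" for u
    by (rule Lim_norm_ubound[OF _ qpoch_tendsto_inf[OF q]]) (use C that in auto)
  with C(1) show ?thesis using that by blast
qed

lemma inverse_qpoch_bound:
  assumes q: "cmod q < 1" and nz: "\<And>k. qpoch q v k \<noteq> 0"
  obtains C where "C > 0" "\<And>k. cmod (1 / qpoch q v k) \<le> C"
proof -
  have "qpoch_inf q v \<noteq> 0" using nz qpoch_inf_nonzero_iff[OF q] by blast
  then have "(\<lambda>k. 1 / qpoch q v k) \<longlonglongrightarrow> 1 / qpoch_inf q v"
    by (intro tendsto_intros qpoch_tendsto_inf q)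
  then have "Bseq (\<lambda>k. 1 / qpoch q v k)"
    using convergent_imp_Bseq convergentI by blast
  then show ?thesis using that unfolding Bseq_def by blast
qed

lemma qpoch_inf_holomorphic: 
  assumes q: "cmod q < 1"
  shows "qpoch_inf q holomorphic_on UNIV"
proof (rule holomorphic_uniform_sequence)
  show "(\<lambda>z. qpoch q z k) holomorphic_on UNIV" for k
    unfolding qpoch_def by (intro holomorphic_intros)
  fix z :: complex
  have "uniformly_convergent_on (cball z 1) (\<lambda>N z. \<Prod>n<N. 1 - z * q ^ n)"
  proof (rule uniformly_convergent_on_prod')
    show "uniformly_convergent_on (cball z 1) (\<lambda>N z. \<Sum>n<N. norm (1 - z * q ^ n - 1))"
    proof (rule Weierstrass_m_test')
      fix n w assume "w \<in> cball z 1"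
      then have "norm w \<le> norm z + 1"
        using norm_triangle_ineq2[of w z] by (simp add: dist_norm norm_minus_commute)
      then show "norm (norm (1 - w * q ^ n - 1)) \<le> (norm z + 1) * cmod q ^ n"
        by (simp add: norm_mult norm_power mult_right_mono)
    next
      show "summable (\<lambda>n. (norm z + 1) * cmod q ^ n)"
        using q by (intro summable_mult summable_geometric) auto
    qed
  qed (auto intro!: continuous_intros)
  then obtain g where g: "uniform_limit (cball z 1) (\<lambda>N z. qpoch q z N) g sequentially"
    unfolding qpoch_def uniformly_convergent_on_def by blast
  have "g w = qpoch_inf q w" if "w \<in> cball z 1" for w
    using tendsto_uniform_limitI[OF g that] qpoch_tendsto_inf[OF q] LIMSEQ_unique by blast
  then have "uniform_limit (cball z 1) (\<lambda>N z. qpoch q z N) g sequentially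
      = uniform_limit (cball z 1) (\<lambda>N z. qpoch q z N) (qpoch_inf q) sequentially"
    by (intro uniform_limit_cong') auto
  then have "uniform_limit (cball z 1) (\<lambda>N z. qpoch q z N) (qpoch_inf q) sequentially"
    using g by simp
  then show "\<exists>d>0. cball z d \<subseteq> UNIV \<and> uniform_limit (cball z d) (\<lambda>N z. qpoch q z N) (qpoch_inf q) sequentially"
    by (intro exI[of _ 1]) auto
qed auto

lemma holomorphic_on_qpoch_inf [holomorphic_intros]:
  assumes "cmod q < 1" "f holomorphic_on S"
  shows "(\<lambda>z. qpoch_inf q (f z)) holomorphic_on S"
  using holomorphic_on_compose_gen[OF assms(2) qpoch_inf_holomorphic[OF assms(1)]] by (simp add: o_def)

text \<open>The divided difference of the function \<open>q ^ m \<mapsto> f m\<close> at the nodes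
  \<open>q ^ i, \<dots>, q ^ (i + l)\<close>, see \<open>ddiff_Suc\<close>.\<close>

definition ddiff :: "complex \<Rightarrow> nat \<Rightarrow> (nat \<Rightarrow> complex) \<Rightarrow> nat \<Rightarrow> complex" where
  "ddiff q l f i = qsum q l (\<lambda>m. f (i + m)) / (q ^ (i * l) * qpoch q q l)"

text \<open>Every rate above \<open>r\<close>, rather than \<open>r\<close> itself: in the Leibniz
  rule two equal rates would cost a factor \<open>l + 1\<close>, while the class defined here is
  closed under products. Uniformity in \<open>i\<close> is required because that rule evaluates the
  second factor at shifted nodes.\<close>

definition dd_growth :: "complex \<Rightarrow> real \<Rightarrow> (nat \<Rightarrow> complex) \<Rightarrow> bool" where
  "dd_growth q r f \<longleftrightarrow> (\<forall>\<rho>>r. \<exists>C>0. \<forall>i l. cmod (ddiff q l f i) \<le> C * \<rho> ^ l)"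

section \<open>Divided differences at geometric nodes and their growth\<close>

context
  fixes q :: complex
  assumes q: "q \<noteq> 0" "cmod q < 1"
begin

lemma ddiff_0 [simp]: "ddiff q 0 f i = f i"
  by (simp add: ddiff_def)

text \<open>The Pascal rule \<open>qsum_Suc\<close> after normalisation. The power
  \<open>q ^ (i * l)\<close> is there because multiplying all nodes by \<open>q ^ i\<close> divides
  a difference of order \<open>l\<close> by it.\<close>

lemma ddiff_Suc:
  "(q ^ (i + Suc l) - q ^ i) * ddiff q (Suc l) f i = ddiff q l f (Suc i) - ddiff q l f i"
proof -
  define G where "G = qsum q l (\<lambda>m. f (i + m))"
  define G' where "G' = qsum q l (\<lambda>m. f (Suc i + m))"
  have G: "qsum q (Suc l) (\<lambda>m. f (i + m)) = G - G' / q ^ l"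
    unfolding qsum_Suc[OF q] G_def G'_def by (simp add: power_int_minus divide_inverse mult.commute)
  have nz: "qpoch q q l \<noteq> 0" "1 - q * q ^ l \<noteq> 0"
    using qpoch_self_nonzero[OF q(2)] power_neq_1[OF q(2), of "Suc l"] by auto
  have "q ^ (i + Suc l) - q ^ i = - (q ^ i * (1 - q * q ^ l))"
    by (simp add: power_add algebra_simps)
  then have "(q ^ (i + Suc l) - q ^ i) * ddiff q (Suc l) f i
      = - (q ^ i * (1 - q * q ^ l)) * ((G - G' / q ^ l) / (q ^ i * q ^ (i * l) * (qpoch q q l * (1 - q * q ^ l))))"
    unfolding ddiff_def G by (simp add: qpoch_Suc power_add)
  also have "\<dots> = - ((G - G' / q ^ l) / (q ^ (i * l) * qpoch q q l))"
    using nz q by simp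
  also have "\<dots> = G' / (q ^ l * q ^ (i * l) * qpoch q q l) - G / (q ^ (i * l) * qpoch q q l)"
    by (simp add: diff_divide_distrib mult_ac)
  also have "\<dots> = ddiff q l f (Suc i) - ddiff q l f i"
    unfolding ddiff_def G_def G'_def by (simp add: power_add)
  finally show ?thesis .
qed

text \<open>The nodes are distinct, so the recursion determines all orders from order 0. Closed
  forms are verified below merely by checking it.\<close>

lemma ddiff_unique:
  assumes "\<And>i. D 0 i = f i"
    and "\<And>l i. (q ^ (i + Suc l) - q ^ i) * D (Suc l) i = D l (Suc i) - D l i"
  shows "ddiff q l f i = D l i"
proof (induction l arbitrary: i)
  case (Suc l)
  have "q ^ (i + Suc l) - q ^ i \<noteq> 0"
    using power_neq_1[OF q(2), of "Suc l"] q(1) by (simp add: power_add)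
  moreover have "(q ^ (i + Suc l) - q ^ i) * ddiff q (Suc l) f i = (q ^ (i + Suc l) - q ^ i) * D (Suc l) i"
    unfolding ddiff_Suc assms(2) Suc ..
  ultimately show ?case by simp
qed (simp add: assms)

lemma ddiff_mult:
  "ddiff q l (\<lambda>m. f m * g m) i = (\<Sum>j\<le>l. ddiff q j f i * ddiff q (l - j) g (i + j))"
proof (rule ddiff_unique)
  fix l i
  let ?D = "\<lambda>j. ddiff q j f i" and ?E = "\<lambda>j k. ddiff q j g k"
  \<comment> \<open>The node difference is split at the intermediate node
    \<open>q ^ (i + j)\<close>. The first part vanishes at \<open>j = 0\<close>, the second at
    \<open>j = Suc l\<close>, so the recursions for \<open>f\<close> and \<open>g\<close> apply to
    the remaining terms; their mixed products then cancel.\<close>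
  have "(q ^ (i + Suc l) - q ^ i) * (\<Sum>j\<le>Suc l. ?D j * ?E (Suc l - j) (i + j))
     = (\<Sum>j\<le>Suc l. ((q ^ (i + j) - q ^ i) * ?D j) * ?E (Suc l - j) (i + j))
     + (\<Sum>j\<le>Suc l. ?D j * ((q ^ (i + Suc l) - q ^ (i + j)) * ?E (Suc l - j) (i + j)))"
    unfolding sum_distrib_left sum.distrib[symmetric] by (rule sum.cong) (auto simp: algebra_simps)
  also have "(\<Sum>j\<le>Suc l. ((q ^ (i + j) - q ^ i) * ?D j) * ?E (Suc l - j) (i + j))
     = (\<Sum>j\<le>l. (ddiff q j f (Suc i) - ?D j) * ?E (l - j) (Suc (i + j)))"
    unfolding sum.atMost_Suc_shift ddiff_Suc by simp
  also have "(\<Sum>j\<le>Suc l. ?D j * ((q ^ (i + Suc l) - q ^ (i + j)) * ?E (Suc l - j) (i + j)))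
     = (\<Sum>j\<le>l. ?D j * (?E (l - j) (Suc (i + j)) - ?E (l - j) (i + j)))"
  proof -
    have "(q ^ (i + Suc l) - q ^ (i + j)) * ?E (Suc l - j) (i + j)
        = ?E (l - j) (Suc (i + j)) - ?E (l - j) (i + j)" if "j \<le> l" for j
      using ddiff_Suc[of "i + j" "l - j" g] that by (simp add: Suc_diff_le)
    then show ?thesis by simp
  qed
  also have "(\<Sum>j\<le>l. (ddiff q j f (Suc i) - ?D j) * ?E (l - j) (Suc (i + j))) +
      (\<Sum>j\<le>l. ?D j * (?E (l - j) (Suc (i + j)) - ?E (l - j) (i + j)))
    = (\<Sum>j\<le>l. ddiff q j f (Suc i) * ?E (l - j) (Suc i + j)) - (\<Sum>j\<le>l. ?D j * ?E (l - j) (i + j))"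
    unfolding sum_subtractf[symmetric] sum.distrib[symmetric]
    by (rule sum.cong) (auto simp: algebra_simps)
  finally show "(q ^ (i + Suc l) - q ^ i) * (\<Sum>j\<le>Suc l. ?D j * ?E (Suc l - j) (i + j)) = \<dots>" .
qed simp

text \<open>Each order costs just one factor \<open>u\<close>: this is the source of the geometric
  rate, despite the large weights in \<open>qsum\<close>.\<close>

lemma ddiff_qpoch: "ddiff q l (qpoch q u) i = qpoch q u i * u ^ l / qpoch q q l"
proof (rule ddiff_unique)
  fix l i
  have nz: "1 - q * q ^ l \<noteq> 0"
    using power_neq_1[OF q(2), of "Suc l"] by auto
  have "(q ^ (i + Suc l) - q ^ i) * (P * u ^ Suc l / (Q * (1 - q * q ^ l)))
      = P * (1 - u * q ^ i) * u ^ l / Q - P * u ^ l / Q" for P Q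
  proof -
    have "(q ^ (i + Suc l) - q ^ i) * (P * u ^ Suc l / (Q * (1 - q * q ^ l)))
      = - (q ^ i) * P * u ^ Suc l * (1 - q * q ^ l) / (Q * (1 - q * q ^ l))"
      by (simp add: power_add algebra_simps)
    also have "\<dots> = - (q ^ i) * P * u ^ Suc l / Q" using nz by simp
    also have "\<dots> = P * (1 - u * q ^ i) * u ^ l / Q - P * u ^ l / Q"
      unfolding diff_divide_distrib[symmetric] by (simp add: algebra_simps)
    finally show ?thesis .
  qed
  then show "(q ^ (i + Suc l) - q ^ i) * (qpoch q u i * u ^ Suc l / qpoch q q (Suc l))
      = qpoch q u (Suc i) * u ^ l / qpoch q q l - qpoch q u i * u ^ l / qpoch q q l"
    unfolding qpoch_Suc .
qed simp

text \<open>The numerator is written with \<open>0 -\<close> to match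
  \<open>norm_shifted_prod_bound\<close> with \<open>a = 0\<close>.\<close>

lemma ddiff_inverse_qpoch:
  assumes "\<And>k. qpoch q v k \<noteq> 0"
  shows "ddiff q l (\<lambda>m. 1 / qpoch q v m) i = (\<Prod>j<l. 0 - v * q ^ j) / (qpoch q v (i + l) * qpoch q q l)"
proof (rule ddiff_unique)
  fix l i
  have nz: "1 - q * q ^ l \<noteq> 0" "qpoch q q l \<noteq> 0"
    using qpoch_self_nonzero[OF q(2)] power_neq_1[OF q(2), of "Suc l"] by auto
  have nzv: "qpoch q v (i + l) \<noteq> 0" "1 - v * q ^ (i + l) \<noteq> 0"
    using assms[of "i + l"] assms[of "Suc (i + l)"] by (auto simp: qpoch_Suc)
  define P where "P = (\<Prod>j<l. 0 - v * q ^ j)"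
  have "(q ^ (i + Suc l) - q ^ i) * (P * (0 - v * q ^ l) / (V * W * (Q * (1 - q * q ^ l))))
     = P / (V * W * Q) - P / (V * Q)" if "V \<noteq> 0" "W \<noteq> 0" "Q \<noteq> 0" "W = 1 - v * q ^ (i + l)" for V W Q
  proof -
    have "(q ^ (i + Suc l) - q ^ i) * (P * (0 - v * q ^ l) / (V * W * (Q * (1 - q * q ^ l))))
       = v * q ^ (i + l) * P * (1 - q * q ^ l) / (V * W * Q * (1 - q * q ^ l))"
    proof -
      have "(q ^ (i + Suc l) - q ^ i) * (P * (0 - v * q ^ l)) = v * q ^ (i + l) * P * (1 - q * q ^ l)"
        by (simp add: power_add algebra_simps)
      then show ?thesis by (simp only: times_divide_eq_right mult.assoc)
    qed
    also have "\<dots> = (1 - W) * P / (V * W * Q)" using nz that(4) by simp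
    also have "\<dots> = P / (V * W * Q) - P / (V * Q)"
      using that(1-3) by (simp add: field_simps)
    finally show ?thesis .
  qed
  from this[OF nzv nz(2) refl]
  show "(q ^ (i + Suc l) - q ^ i) * ((\<Prod>j<Suc l. 0 - v * q ^ j) / (qpoch q v (i + Suc l) * qpoch q q (Suc l)))
    = (\<Prod>j<l. 0 - v * q ^ j) / (qpoch q v (Suc i + l) * qpoch q q l)
      - (\<Prod>j<l. 0 - v * q ^ j) / (qpoch q v (i + l) * qpoch q q l)"
    by (simp add: P_def qpoch_Suc)
qed simp

lemma ddiff_mult_bound:
  assumes f: "\<And>i l. cmod (ddiff q l f i) \<le> C1 * \<rho>1 ^ l"
    and g: "\<And>i l. cmod (ddiff q l g i) \<le> C2 * \<rho>2 ^ l"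
    and \<rho>: "0 \<le> \<rho>1" "\<rho>1 < \<rho>2" and C: "C1 > 0" "C2 > 0"
  shows "cmod (ddiff q l (\<lambda>m. f m * g m) i) \<le> C1 * C2 / (1 - \<rho>1 / \<rho>2) * \<rho>2 ^ l"
proof -
  have "cmod (ddiff q l (\<lambda>m. f m * g m) i) \<le> (\<Sum>j\<le>l. cmod (ddiff q j f i) * cmod (ddiff q (l - j) g (i + j)))"
    unfolding ddiff_mult norm_mult[symmetric] by (rule norm_sum)
  also have "\<dots> \<le> (\<Sum>j\<le>l. (C1 * \<rho>1 ^ j) * (C2 * \<rho>2 ^ (l - j)))"
    using \<rho> C by (intro sum_mono mult_mono f g) auto
  also have "\<dots> = C1 * C2 * \<rho>2 ^ l * (\<Sum>j\<le>l. (\<rho>1 / \<rho>2) ^ j)"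
  proof -
    have "(C1 * \<rho>1 ^ j) * (C2 * \<rho>2 ^ (l - j)) = C1 * C2 * \<rho>2 ^ l * (\<rho>1 / \<rho>2) ^ j" if "j \<le> l" for j
    proof -
      have "\<rho>2 ^ (l - j) = \<rho>2 ^ l / \<rho>2 ^ j" using that \<rho> by (simp add: power_diff)
      then show ?thesis by (simp add: power_divide)
    qed
    then show ?thesis unfolding sum_distrib_left by (intro sum.cong) auto
  qed
  also have "\<dots> \<le> C1 * C2 * \<rho>2 ^ l * (1 / (1 - \<rho>1 / \<rho>2))"
  proof (intro mult_left_mono)
    have "(\<Sum>j\<le>l. (\<rho>1 / \<rho>2) ^ j) = (\<Sum>j<Suc l. (\<rho>1 / \<rho>2) ^ j)"
      by (simp add: lessThan_Suc_atMost)
    also have "\<dots> \<le> (\<Sum>j. (\<rho>1 / \<rho>2) ^ j)"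
      using \<rho> by (intro sum_le_suminf summable_geometric) auto
    also have "\<dots> = 1 / (1 - \<rho>1 / \<rho>2)"
      using \<rho> by (intro suminf_geometric) auto
    finally show "(\<Sum>j\<le>l. (\<rho>1 / \<rho>2) ^ j) \<le> 1 / (1 - \<rho>1 / \<rho>2)" .
  qed (use \<rho> C in auto)
  finally show ?thesis by (simp add: mult_ac)
qed

lemma dd_growth_mult:
  assumes "0 \<le> r" "dd_growth q r f" "dd_growth q r g"
  shows "dd_growth q r (\<lambda>m. f m * g m)"
  unfolding dd_growth_def
proof (intro allI impI)
  fix \<rho> :: real assume \<rho>: "\<rho> > r"
  \<comment> \<open>Strictly between \<open>r\<close> and \<rho>: with \<open>f\<close> bounded at
    rate \<rho>1 and \<open>g\<close> at rate \<rho>, the Leibniz sum is dominated by a convergent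
    geometric series of ratio \<rho>1 / \<rho>.\<close>
  define \<rho>1 where "\<rho>1 = (r + \<rho>) / 2"
  have \<rho>1: "r < \<rho>1" "0 \<le> \<rho>1" "\<rho>1 < \<rho>" using \<rho> assms(1) by (auto simp: \<rho>1_def)
  obtain C1 C2 where C: "C1 > 0" "\<And>i l. cmod (ddiff q l f i) \<le> C1 * \<rho>1 ^ l"
    "C2 > 0" "\<And>i l. cmod (ddiff q l g i) \<le> C2 * \<rho> ^ l"
    using assms(2,3) \<rho>1(1) \<rho> unfolding dd_growth_def by meson
  show "\<exists>C>0. \<forall>i l. cmod (ddiff q l (\<lambda>m. f m * g m) i) \<le> C * \<rho> ^ l"
    using ddiff_mult_bound[OF C(2) C(4) \<rho>1(2,3) C(1,3)] C(1,3) \<rho>1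
    by (intro exI[of _ "C1 * C2 / (1 - \<rho>1 / \<rho>)"]) auto
qed

text \<open>The constant is chosen before \<open>u\<close> and \<rho>, because
  \<open>qsum_growth\<close> applies the bound to the parameter \<open>\<alpha> * q ^ k\<close>,
  which moves with the order.\<close>

lemma ddiff_qpoch_bound:
  assumes "0 \<le> U"
  obtains C where "C > 0" "\<And>u \<rho> i l. cmod u \<le> U \<Longrightarrow> cmod u \<le> \<rho> \<Longrightarrow> cmod (ddiff q l (qpoch q u) i) \<le> C * \<rho> ^ l"
proof -
  obtain C1 where C1: "C1 > 0" "\<And>u k. cmod u \<le> U \<Longrightarrow> cmod (qpoch q u k) \<le> C1"
    using qpoch_bound[OF q(2) assms] by blast
  obtain C2 where C2: "C2 > 0" "\<And>k. cmod (1 / qpoch q q k) \<le> C2"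
    using inverse_qpoch_bound[OF q(2) qpoch_self_nonzero[OF q(2)]] by blast
  have "cmod (ddiff q l (qpoch q u) i) \<le> C1 * C2 * \<rho> ^ l" if "cmod u \<le> U" "cmod u \<le> \<rho>" for u \<rho> i l
  proof -
    have "cmod (ddiff q l (qpoch q u) i) = cmod (qpoch q u i) * cmod (1 / qpoch q q l) * cmod u ^ l"
      unfolding ddiff_qpoch by (simp add: norm_mult norm_divide norm_power)
    also have "\<dots> \<le> C1 * C2 * \<rho> ^ l"
      using C1 C2 that by (intro mult_mono power_mono) (auto intro!: mult_nonneg_nonneg simp del: norm_divide)
    finally show ?thesis .
  qed
  moreover have "C1 * C2 > 0" using C1 C2 by simp
  ultimately show ?thesis using that by blast
qed

lemma dd_growth_qpoch:
  assumes "cmod u \<le> r"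
  shows "dd_growth q r (qpoch q u)"
  unfolding dd_growth_def using ddiff_qpoch_bound[of "cmod u"] assms
  by (metis less_eq_real_def norm_ge_zero order_trans)

text \<open>The product in \<open>ddiff_inverse_qpoch\<close> contains the power q^(l(l-1)/2), so
  any positive rate dominates it, however large \<open>v\<close> is. Denominators therefore leave
  the rate of a quotient unchanged.\<close>

lemma dd_growth_inverse_qpoch:
  assumes "0 \<le> r" and nz: "\<And>k. qpoch q v k \<noteq> 0"
  shows "dd_growth q r (\<lambda>m. 1 / qpoch q v m)"
  unfolding dd_growth_def
proof (intro allI impI)
  fix \<rho> assume \<rho>: "\<rho> > r"
  obtain C1 where C1: "C1 > 0" "\<And>a u k. cmod a \<le> \<rho> \<Longrightarrow> cmod u \<le> cmod v \<Longrightarrow> cmod (\<Prod>i<k. a - u * q ^ i) \<le> C1 * \<rho> ^ k"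
    using norm_shifted_prod_bound[OF q(2), of \<rho> "cmod v"] \<rho> assms(1) by auto
  obtain C2 where C2: "C2 > 0" "\<And>k. cmod (1 / qpoch q q k) \<le> C2"
    using inverse_qpoch_bound[OF q(2) qpoch_self_nonzero[OF q(2)]] by blast
  obtain C3 where C3: "C3 > 0" "\<And>k. cmod (1 / qpoch q v k) \<le> C3"
    using inverse_qpoch_bound[OF q(2) nz] by blast
  have "cmod (ddiff q l (\<lambda>m. 1 / qpoch q v m) i) \<le> C1 * C3 * C2 * \<rho> ^ l" for i l
  proof -
    have "cmod (ddiff q l (\<lambda>m. 1 / qpoch q v m) i)
      = cmod (\<Prod>j<l. 0 - v * q ^ j) * cmod (1 / qpoch q v (i + l)) * cmod (1 / qpoch q q l)"
      unfolding ddiff_inverse_qpoch[OF nz] by (simp add: norm_mult norm_divide)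
    also have "\<dots> \<le> C1 * \<rho> ^ l * C3 * C2"
      using C1(1) C2(1) C3(1) \<rho> assms(1) by (intro mult_mono C1(2) C2(2) C3(2)) auto
    finally show ?thesis by (simp add: mult_ac)
  qed
  then show "\<exists>C>0. \<forall>i l. cmod (ddiff q l (\<lambda>m. 1 / qpoch q v m) i) \<le> C * \<rho> ^ l"
    using C1 C2 C3 by (intro exI[of _ "C1 * C3 * C2"]) auto
qed

text \<open>The parameter \<open>\<alpha> * q ^ k\<close> tends to 0 and is eventually below \<rho>
  / 2, so the Leibniz bound applies with rates \<rho> / 2 and \<rho>. The finitely many earlier
  \<open>k\<close> only enlarge the constant, and the rate is governed by \<open>h\<close>
  alone.\<close>

lemma qsum_growth:
  assumes "0 \<le> r" "dd_growth q r h" "r < \<rho>"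
  obtains C where "C > 0" "\<And>k. cmod (qsum q k (\<lambda>m. qpoch q (\<alpha> * q ^ k) m * h m)) \<le> C * \<rho> ^ k"
proof -
  define S where "S = (\<lambda>k. qsum q k (\<lambda>m. qpoch q (\<alpha> * q ^ k) m * h m))"
  have \<rho>: "\<rho> > 0" using assms by simp
  obtain C1 where C1: "C1 > 0"
    "\<And>u \<rho> i l. cmod u \<le> cmod \<alpha> \<Longrightarrow> cmod u \<le> \<rho> \<Longrightarrow> cmod (ddiff q l (qpoch q u) i) \<le> C1 * \<rho> ^ l"
    using ddiff_qpoch_bound[of "cmod \<alpha>"] by auto
  obtain C2 where C2: "C2 > 0" "\<And>i l. cmod (ddiff q l h i) \<le> C2 * \<rho> ^ l"
    using assms unfolding dd_growth_def by meson
  obtain C3 where C3: "C3 > 0" "\<And>u k. cmod u \<le> cmod q \<Longrightarrow> cmod (qpoch q u k) \<le> C3"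
    using qpoch_bound[OF q(2), of "cmod q"] by auto
  have "(\<lambda>k. cmod (\<alpha> * q ^ k)) \<longlonglongrightarrow> cmod (\<alpha> * 0)"
    using q(2) by (intro tendsto_intros LIMSEQ_power_zero)
  then have "\<forall>\<^sub>F k in sequentially. cmod (\<alpha> * q ^ k) < \<rho> / 2"
    by (rule order_tendstoD(2)) (use \<rho> in simp)
  then have "\<forall>\<^sub>F k in sequentially. norm (S k / of_real \<rho> ^ k) \<le> norm (C3 * (C1 * C2 / (1 - (\<rho> / 2) / \<rho>)))"
  proof eventually_elim
    case (elim k)
    have le: "cmod (\<alpha> * q ^ k) \<le> cmod \<alpha>"
      using q by (simp add: norm_mult norm_power mult_left_le power_le_one)
    have "S k = ddiff q k (\<lambda>m. qpoch q (\<alpha> * q ^ k) m * h m) 0 * qpoch q q k"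
      using qpoch_self_nonzero[OF q(2)] by (simp add: ddiff_def S_def)
    then have "cmod (S k) = cmod (ddiff q k (\<lambda>m. qpoch q (\<alpha> * q ^ k) m * h m) 0) * cmod (qpoch q q k)"
      by (simp add: norm_mult)
    also have "\<dots> \<le> (C1 * C2 / (1 - (\<rho> / 2) / \<rho>) * \<rho> ^ k) * C3"
    proof (rule mult_mono)
      show "cmod (ddiff q k (\<lambda>m. qpoch q (\<alpha> * q ^ k) m * h m) 0) \<le> C1 * C2 / (1 - \<rho> / 2 / \<rho>) * \<rho> ^ k"
        using elim \<rho> C1(1) C2 by (intro ddiff_mult_bound C1(2)[OF le]) auto
    qed (use C1 C2 C3 \<rho> in auto)
    finally have "cmod (S k) / \<rho> ^ k \<le> C3 * (C1 * C2 / (1 - (\<rho> / 2) / \<rho>))"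
      using \<rho> by (simp add: field_simps)
    then show ?case using \<rho> by (simp add: norm_divide norm_power)
  qed
  then have "Bseq (\<lambda>k. S k / of_real \<rho> ^ k)"
    by (rule Bseq_eventually_mono) (rule convergent_imp_Bseq[OF convergent_const])
  then obtain C where C: "C > 0" "\<And>k. norm (S k / of_real \<rho> ^ k) \<le> C"
    unfolding Bseq_def by blast
  have "cmod (S k) \<le> C * \<rho> ^ k" for k
    using C(2)[of k] \<rho> by (simp add: norm_divide norm_power field_simps)
  then show ?thesis using that C(1) unfolding S_def by blast
qed

end

section \<open>The one-variable expansion\<close>

definition qratio :: "complex \<Rightarrow> complex \<Rightarrow> complex \<Rightarrow> complex \<Rightarrow> complex \<Rightarrow> complex \<Rightarrow> nat \<Rightarrow> complex" where
  "qratio q u1 u2 v1 v2 v3 m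
    = qpoch q u1 m * qpoch q u2 m / (qpoch q v1 m * qpoch q v2 m * qpoch q v3 m)"

text \<open>Each (z)_M in \<open>qratio\<close> is written as (z)_inf / (z q^M)_inf and
  \<open>q ^ M\<close> is replaced by \<open>y\<close>.\<close>

definition qratio_inf :: "complex \<Rightarrow> complex \<Rightarrow> complex \<Rightarrow> complex \<Rightarrow> complex \<Rightarrow> complex \<Rightarrow> complex \<Rightarrow> complex" where
  "qratio_inf q u1 u2 v1 v2 v3 y
    = qpoch_inf q (v1 * y) * qpoch_inf q (v2 * y) * qpoch_inf q (v3 * y) * qpoch_inf q u1 * qpoch_inf q u2
      / (qpoch_inf q v1 * qpoch_inf q v2 * qpoch_inf q v3 * qpoch_inf q (u1 * y) * qpoch_inf q (u2 * y))"

text \<open>Collects what does not depend on \<open>Y\<close>, so that one growth bound serves a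
  whole disc of values of \<open>Y\<close>.\<close>

definition expansion_coeff :: "complex \<Rightarrow> complex \<Rightarrow> (nat \<Rightarrow> complex) \<Rightarrow> nat \<Rightarrow> complex" where
  "expansion_coeff q \<alpha> h k = (1 - \<alpha> * q ^ (2 * k)) * qpoch q \<alpha> k / ((1 - \<alpha>) * qpoch q q k)
     * qsum q k (\<lambda>m. qpoch q (\<alpha> * q ^ k) m * h m)"

context
  fixes q :: complex
  assumes q: "q \<noteq> 0" "cmod q < 1"
begin

lemma qratio_inf_power:
  assumes "qpoch_inf q v1 \<noteq> 0" "qpoch_inf q v2 \<noteq> 0" "qpoch_inf q v3 \<noteq> 0"
    and "qpoch_inf q (u1 * q ^ M) \<noteq> 0" "qpoch_inf q (u2 * q ^ M) \<noteq> 0"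
  shows "qratio_inf q u1 u2 v1 v2 v3 (q ^ M) = qratio q u1 u2 v1 v2 v3 M"
proof -
  note split = qpoch_inf_split[OF q(2), of _ M]
  have "qpoch q v1 M \<noteq> 0" "qpoch q v2 M \<noteq> 0" "qpoch q v3 M \<noteq> 0"
    "qpoch_inf q (v1 * q ^ M) \<noteq> 0" "qpoch_inf q (v2 * q ^ M) \<noteq> 0" "qpoch_inf q (v3 * q ^ M) \<noteq> 0"
    using assms(1-3) unfolding split[of v1] split[of v2] split[of v3] by auto
  then show ?thesis
    unfolding qratio_inf_def qratio_def split[of v1] split[of v2] split[of v3] split[of u1] split[of u2]
    using assms(4,5) by (simp add: field_simps)
qed

lemma dd_growth_qratio:
  assumes "\<And>k. qpoch q v1 k \<noteq> 0" "\<And>k. qpoch q v2 k \<noteq> 0" "\<And>k. qpoch q v3 k \<noteq> 0"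
  shows "dd_growth q (max (cmod u1) (cmod u2)) (qratio q u1 u2 v1 v2 v3)"
proof -
  have r: "0 \<le> max (cmod u1) (cmod u2)" by (simp add: max_def)
  have "dd_growth q (max (cmod u1) (cmod u2))
      (\<lambda>m. qpoch q u1 m * qpoch q u2 m * (1 / qpoch q v1 m) * (1 / qpoch q v2 m) * (1 / qpoch q v3 m))"
    by (intro dd_growth_mult dd_growth_qpoch dd_growth_inverse_qpoch q r assms) auto
  moreover have "qratio q u1 u2 v1 v2 v3
     = (\<lambda>m. qpoch q u1 m * qpoch q u2 m * (1 / qpoch q v1 m) * (1 / qpoch q v2 m) * (1 / qpoch q v3 m))"
    by (rule ext) (simp add: qratio_def)
  ultimately show ?thesis by simp
qed

lemma expansion_coeff_growth:
  assumes "0 \<le> r" "dd_growth q r h" "r < \<rho>"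
  obtains C where "C > 0" "\<And>k. cmod (expansion_coeff q \<alpha> h k) \<le> C * \<rho> ^ k"
proof -
  have \<rho>: "\<rho> > 0" using assms by simp
  obtain C1 where C1: "C1 > 0" "\<And>k. cmod (qsum q k (\<lambda>m. qpoch q (\<alpha> * q ^ k) m * h m)) \<le> C1 * \<rho> ^ k"
    using qsum_growth[OF q assms] by blast
  obtain C2 where C2: "C2 > 0" "\<And>u k. cmod u \<le> cmod \<alpha> \<Longrightarrow> cmod (qpoch q u k) \<le> C2"
    using qpoch_bound[OF q(2), of "cmod \<alpha>"] by auto
  obtain C3 where C3: "C3 > 0" "\<And>k. cmod (1 / qpoch q q k) \<le> C3"
    using inverse_qpoch_bound[OF q(2) qpoch_self_nonzero[OF q(2)]] by blast
  \<comment> \<open>For \<alpha> = 1 the quotient \<open>1 / (1 - \<alpha>)\<close> is 0 by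
    convention, and the summand 1 keeps \<open>C\<close> positive.\<close>
  define C where "C = (1 + cmod \<alpha>) * C2 * cmod (1 / (1 - \<alpha>)) * C3 * C1 + 1"
  have "cmod (expansion_coeff q \<alpha> h k) \<le> C * \<rho> ^ k" for k
  proof -
    have "cmod (1 - \<alpha> * q ^ (2 * k)) \<le> 1 + cmod \<alpha> * cmod q ^ (2 * k)"
      using norm_triangle_ineq4[of 1 "\<alpha> * q ^ (2 * k)"] by (simp add: norm_mult norm_power)
    also have "\<dots> \<le> 1 + cmod \<alpha>"
      using q by (simp add: mult_left_le power_le_one)
    finally have 1: "cmod (1 - \<alpha> * q ^ (2 * k)) \<le> 1 + cmod \<alpha>" .
    have "cmod (expansion_coeff q \<alpha> h k) = cmod (1 - \<alpha> * q ^ (2 * k)) * cmod (qpoch q \<alpha> k)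
      * cmod (1 / (1 - \<alpha>)) * cmod (1 / qpoch q q k) * cmod (qsum q k (\<lambda>m. qpoch q (\<alpha> * q ^ k) m * h m))"
      unfolding expansion_coeff_def by (simp add: norm_mult norm_divide)
    also have "\<dots> \<le> (1 + cmod \<alpha>) * C2 * cmod (1 / (1 - \<alpha>)) * C3 * (C1 * \<rho> ^ k)"
      using C1(1) C2(1) C3(1) \<rho> by (intro mult_mono 1 C1(2) C2(2) C3(2)) auto
    also have "\<dots> \<le> C * \<rho> ^ k"
      using \<rho> by (simp add: C_def algebra_simps)
    finally show ?thesis .
  qed
  moreover have "C > 0"
    using C1 C2 C3 by (auto simp: C_def intro!: add_nonneg_pos mult_nonneg_nonneg)
  ultimately show ?thesis using that by blast
qed

lemma expansion_at_power:
  assumes \<alpha>: "\<alpha> \<noteq> 1" and nz: "\<And>k. qpoch q (\<alpha> * q ^ Suc M) k \<noteq> 0"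
  shows "(\<lambda>k. expansion_coeff q \<alpha> h k * (\<Prod>i<k. q ^ M - q ^ i) / qpoch q (\<alpha> * q ^ Suc M) k)
    sums (qpoch q (\<alpha> * q) M * h M)"
proof -
  have "(\<lambda>k. expansion_coeff q \<alpha> h k * (\<Prod>i<k. q ^ M - q ^ i) / qpoch q (\<alpha> * q ^ Suc M) k)
    sums (\<Sum>k\<le>M. expansion_coeff q \<alpha> h k * (\<Prod>i<k. q ^ M - q ^ i) / qpoch q (\<alpha> * q ^ Suc M) k)"
    by (rule sums_finite) auto
  also have "(\<Sum>k\<le>M. expansion_coeff q \<alpha> h k * (\<Prod>i<k. q ^ M - q ^ i) / qpoch q (\<alpha> * q ^ Suc M) k)
      = qpoch q (\<alpha> * q) M * h M"
    unfolding terminating_expansion[OF q \<alpha> nz, where h = h, symmetric] expansion_coeff_def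
    by (rule sum.cong) (simp_all add: mult_ac)
  finally show ?thesis .
qed

text \<open>Serves twice: as the data at the points \<open>q ^ M\<close> for analytic continuation,
  and by itself for the case where all \<open>a r\<close> are powers of \<open>q\<close>.\<close>

lemma qratio_expansion_terminating:
  assumes \<alpha>: "\<alpha> \<noteq> 1"
    and v: "qpoch_inf q v1 \<noteq> 0" "qpoch_inf q v2 \<noteq> 0" "qpoch_inf q v3 \<noteq> 0"
    and u: "qpoch_inf q (u1 * q ^ M) \<noteq> 0" "qpoch_inf q (u2 * q ^ M) \<noteq> 0"
    and nz: "qpoch_inf q (\<alpha> * q ^ Suc M) \<noteq> 0"
  shows "(\<lambda>k. expansion_coeff q \<alpha> (qratio q u1 u2 v1 v2 v3) k * (\<Prod>i<k. q ^ M - q ^ i)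
      / qpoch q (\<alpha> * q ^ Suc M) k)
    sums (qpoch_inf q (\<alpha> * q) / qpoch_inf q (\<alpha> * q ^ Suc M) * qratio_inf q u1 u2 v1 v2 v3 (q ^ M))"
proof -
  have "\<alpha> * q * q ^ M = \<alpha> * q ^ Suc M" by simp
  then have "qpoch_inf q (\<alpha> * q) / qpoch_inf q (\<alpha> * q ^ Suc M) = qpoch q (\<alpha> * q) M"
    using qpoch_inf_split[OF q(2), of "\<alpha> * q" M] nz by (simp add: mult.assoc)
  then show ?thesis
    unfolding qratio_inf_power[OF v u]
    using expansion_at_power[OF \<alpha>, of M "qratio q u1 u2 v1 v2 v3"] nz qpoch_inf_nonzero_iff[OF q(2)] by simp
qed

lemma qratio_expansion:
  assumes \<alpha>: "\<alpha> \<noteq> 1"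
    and v: "qpoch_inf q v1 \<noteq> 0" "qpoch_inf q v2 \<noteq> 0" "qpoch_inf q v3 \<noteq> 0"
    and Y: "cmod (u1 * Y) < 1" "cmod (u2 * Y) < 1"
    and nz: "qpoch_inf q (\<alpha> * q * Y) \<noteq> 0"
  shows "(\<lambda>k. expansion_coeff q \<alpha> (qratio q u1 u2 v1 v2 v3) k * (\<Prod>i<k. Y - q ^ i)
      / qpoch q (\<alpha> * q * Y) k)
    sums (qpoch_inf q (\<alpha> * q) / qpoch_inf q (\<alpha> * q * Y) * qratio_inf q u1 u2 v1 v2 v3 Y)"
proof -
  define r where "r = max (cmod u1) (cmod u2)"
  have r: "0 \<le> r" "cmod u1 \<le> r" "cmod u2 \<le> r" "r * cmod Y < 1"
    using Y by (auto simp: r_def max_def norm_mult)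
  \<comment> \<open>Room for a rate above \<open>r\<close> and a radius above |Y| whose product is
    still below 1: the terms then converge uniformly on a disc containing both \<open>Y\<close> and
    0.\<close>
  obtain e where e: "e > 0" "(r + e) * (cmod Y + e) < 1"
  proof -
    have "((\<lambda>e. (r + e) * (cmod Y + e)) \<longlongrightarrow> (r + 0) * (cmod Y + 0)) (at_right 0)"
      by (intro tendsto_intros)
    then have "\<forall>\<^sub>F e in at_right 0. (r + e) * (cmod Y + e) < 1"
      by (rule order_tendstoD(2)) (use r in simp)
    moreover have "\<forall>\<^sub>F e in at_right (0::real). e > 0"
      by (rule eventually_at_right_less)
    ultimately have "\<forall>\<^sub>F e in at_right 0. e > 0 \<and> (r + e) * (cmod Y + e) < 1"
      by eventually_elim auto
    then show ?thesis using that eventually_happens'[OF trivial_limit_at_right_real] by blast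
  qed
  define \<rho> where "\<rho> = r + e"
  define R where "R = cmod Y + e"
  have \<rho>R: "\<rho> > r" "\<rho> > 0" "R > cmod Y" "R > 0" "\<rho> * R < 1"
    using e r by (auto simp: \<rho>_def R_def add_nonneg_pos)
  define h where "h = qratio q u1 u2 v1 v2 v3"
  have vk: "qpoch q v1 k \<noteq> 0" "qpoch q v2 k \<noteq> 0" "qpoch q v3 k \<noteq> 0" for k
    using v qpoch_inf_nonzero_iff[OF q(2)] by auto
  obtain C1 where C1: "C1 > 0" "\<And>k. cmod (expansion_coeff q \<alpha> h k) \<le> C1 * \<rho> ^ k"
    using expansion_coeff_growth[OF r(1) _ \<rho>R(1)] dd_growth_qratio[OF vk] unfolding h_def r_def by metis
  obtain C2 where C2: "C2 > 0" "\<And>a u k. cmod a \<le> R \<Longrightarrow> cmod u \<le> 1 \<Longrightarrow> cmod (\<Prod>i<k. a - u * q ^ i) \<le> C2 * R ^ k"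
    using norm_shifted_prod_bound[OF q(2) \<rho>R(4), of 1] by auto
  obtain C3 where C3: "C3 > 0" "\<And>u. cmod u \<le> cmod \<alpha> * R \<Longrightarrow> cmod (qpoch_inf q u) \<le> C3"
    using qpoch_inf_bound[OF q(2), of "cmod \<alpha> * R"] \<rho>R by auto
  \<comment> \<open>The quotient (\<alpha> q y)_inf / (\<alpha> q y)_k equals (\<alpha> q^(k+1)
    y)_inf, so the multiplied terms are entire.\<close>
  define \<Phi> where "\<Phi> = (\<lambda>k y. expansion_coeff q \<alpha> h k * (\<Prod>i<k. y - q ^ i) * qpoch_inf q (\<alpha> * q ^ Suc k * y))"
  define F where "F = (\<lambda>y. \<Sum>k. \<Phi> k y)"
  define G where "G = (\<lambda>y. qpoch_inf q (\<alpha> * q) * qratio_inf q u1 u2 v1 v2 v3 y)"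
  have bound: "norm (\<Phi> k y) \<le> C1 * C2 * C3 * (\<rho> * R) ^ k" if "y \<in> cball 0 R" for k y
  proof -
    have y: "cmod y \<le> R" using that by simp
    have 2: "cmod (\<Prod>i<k. y - q ^ i) \<le> C2 * R ^ k"
      using C2(2)[OF y, of 1 k] by simp
    have "cmod q ^ Suc k \<le> 1" using q by (intro power_le_one) auto
    then have "cmod \<alpha> * cmod q ^ Suc k * cmod y \<le> cmod \<alpha> * 1 * R"
      using y by (intro mult_mono) auto
    then have 3: "cmod (qpoch_inf q (\<alpha> * q ^ Suc k * y)) \<le> C3"
      by (intro C3(2)) (simp add: norm_mult norm_power)
    have "norm (\<Phi> k y) \<le> (C1 * \<rho> ^ k) * (C2 * R ^ k) * C3"
      unfolding \<Phi>_def norm_mult using C1(1) C2(1) C3(1) \<rho>R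
      by (intro mult_mono C1(2) 2 3) auto
    then show ?thesis by (simp add: power_mult_distrib mult_ac)
  qed
  have summ: "summable (\<lambda>k. C1 * C2 * C3 * (\<rho> * R) ^ k)"
    using \<rho>R by (intro summable_mult summable_geometric) auto
  have sums_F: "(\<lambda>k. \<Phi> k y) sums F y" if "y \<in> cball 0 R" for y
    unfolding F_def by (rule summable_sums[OF summable_comparison_test'[OF summ bound[OF that]]])
  have ulim: "uniform_limit (cball 0 R) (\<lambda>N y. \<Sum>k<N. \<Phi> k y) F sequentially"
    unfolding F_def by (rule Weierstrass_m_test[OF bound summ])
  have holPhi: "(\<lambda>y. \<Sum>k<N. \<Phi> k y) holomorphic_on S" for N S
    unfolding \<Phi>_def by (intro holomorphic_intros q)
  have holF: "F holomorphic_on ball 0 R"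
  proof (rule holomorphic_uniform_limit[OF _ ulim])
    show "\<forall>\<^sub>F N in sequentially. continuous_on (cball 0 R) (\<lambda>y. \<Sum>k<N. \<Phi> k y)
        \<and> (\<lambda>y. \<Sum>k<N. \<Phi> k y) holomorphic_on ball 0 R"
      using holPhi holomorphic_on_imp_continuous_on by (intro always_eventually) blast
  qed auto
  \<comment> \<open>The poles of the product side lie outside the disc, where |u y| is bounded by
    \<rho> R < 1.\<close>
  have uy: "qpoch_inf q (u * y) \<noteq> 0" if "cmod u \<le> r" "y \<in> ball 0 R" for u y
  proof (rule qpoch_inf_nonzero[OF q(2)])
    have "cmod u * cmod y \<le> \<rho> * R"
      using that \<rho>R by (intro mult_mono) auto
    then show "cmod (u * y) < 1" using \<rho>R by (simp add: norm_mult)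
  qed
  have holG: "G holomorphic_on ball 0 R"
    unfolding G_def qratio_inf_def
    by (intro holomorphic_intros q) (use v uy r in auto)
  have "(\<lambda>M. cmod (q ^ M)) \<longlonglongrightarrow> cmod 0"
    using q(2) by (intro tendsto_intros LIMSEQ_power_zero)
  then have ev1: "\<forall>\<^sub>F M in sequentially. cmod (q ^ M) < R"
    by (rule order_tendstoD(2)) (use \<rho>R in simp)
  have "(\<lambda>M. cmod (\<alpha> * q ^ M)) \<longlonglongrightarrow> cmod (\<alpha> * 0)"
    using q(2) by (intro tendsto_intros LIMSEQ_power_zero)
  then have ev2: "\<forall>\<^sub>F M in sequentially. cmod (\<alpha> * q ^ M) < 1"
    by (rule order_tendstoD(2)) simp
  \<comment> \<open>Beyond \<open>M0\<close> the points \<open>q ^ M\<close> lie in the disc, and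
    \<open>\<alpha> * q ^ Suc M\<close> is so small that the infinite product
    \<open>qpoch_inf q z\<close> below is nonzero and may be divided out.\<close>
  obtain M0 where M0: "\<And>M. M \<ge> M0 \<Longrightarrow> cmod (q ^ M) < R" "\<And>M. M \<ge> M0 \<Longrightarrow> cmod (\<alpha> * q ^ M) < 1"
    using eventually_conj[OF ev1 ev2] unfolding eventually_sequentially by blast
  have FG: "F (q ^ M) = G (q ^ M)" if "M \<ge> M0" for M
  proof -
    define z where "z = \<alpha> * q ^ Suc M"
    have qM: "q ^ M \<in> ball 0 R" using M0(1)[OF that] by simp
    have z: "qpoch_inf q z \<noteq> 0"
      using qpoch_inf_nonzero[OF q(2), of z] M0(2)[of "Suc M"] that by (simp add: z_def)
    have zk: "qpoch q z k \<noteq> 0" for k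
      using z qpoch_inf_nonzero_iff[OF q(2)] by blast
    have "\<Phi> k (q ^ M) = qpoch_inf q z * (expansion_coeff q \<alpha> h k * (\<Prod>i<k. q ^ M - q ^ i) / qpoch q z k)" for k
    proof -
      have e: "\<alpha> * q ^ Suc k * q ^ M = z * q ^ k" by (simp add: z_def)
      have "qpoch_inf q (\<alpha> * q ^ Suc k * q ^ M) = qpoch_inf q z / qpoch q z k"
        unfolding e using qpoch_inf_split[OF q(2), of z k] zk[of k] by simp
      then show ?thesis unfolding \<Phi>_def by simp
    qed
    then have "(\<lambda>k. \<Phi> k (q ^ M)) sums (qpoch_inf q z * (qpoch_inf q (\<alpha> * q) / qpoch_inf q z
       * qratio_inf q u1 u2 v1 v2 v3 (q ^ M)))"
      using sums_mult[OF qratio_expansion_terminating[OF \<alpha> v uy[OF r(2) qM] uy[OF r(3) qM] z[unfolded z_def]],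
          of "qpoch_inf q z"] by (simp add: z_def h_def)
    also have "qpoch_inf q z * (qpoch_inf q (\<alpha> * q) / qpoch_inf q z
       * qratio_inf q u1 u2 v1 v2 v3 (q ^ M)) = G (q ^ M)"
      using z by (simp add: G_def)
    finally have "(\<lambda>k. \<Phi> k (q ^ M)) sums G (q ^ M)" .
    moreover have "(\<lambda>k. \<Phi> k (q ^ M)) sums F (q ^ M)"
      using qM by (intro sums_F) auto
    ultimately show ?thesis using sums_unique2 by blast
  qed
  have "F Y - G Y = 0"
  proof (rule analytic_continuation[where f = "\<lambda>y. F y - G y" and S = "ball 0 R" and \<xi> = 0
        and U = "(\<lambda>M. q ^ M) ` {M0..}"])
    show "0 islimpt (\<lambda>M. q ^ M) ` {M0..}"
      unfolding islimpt_sequential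
    proof (intro exI[of _ "\<lambda>M. q ^ (M0 + M)"] conjI allI)
      have "(\<lambda>M. q ^ M0 * q ^ M) \<longlonglongrightarrow> q ^ M0 * 0"
        using q(2) by (intro tendsto_intros LIMSEQ_power_zero)
      then show "(\<lambda>M. q ^ (M0 + M)) \<longlonglongrightarrow> 0" by (simp add: power_add)
    qed (use q in auto)
    show "(\<lambda>y. F y - G y) holomorphic_on ball 0 R"
      by (intro holomorphic_intros holF holG)
  qed (use \<rho>R M0(1) FG in auto)
  then have "(\<lambda>k. \<Phi> k Y) sums G Y"
    using sums_F[of Y] \<rho>R by simp
  then have "(\<lambda>k. \<Phi> k Y / qpoch_inf q (\<alpha> * q * Y)) sums (G Y / qpoch_inf q (\<alpha> * q * Y))"
    by (rule sums_divide)
  moreover have "\<Phi> k Y / qpoch_inf q (\<alpha> * q * Y)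
    = expansion_coeff q \<alpha> h k * (\<Prod>i<k. Y - q ^ i) / qpoch q (\<alpha> * q * Y) k" for k
  proof -
    have e: "\<alpha> * q ^ Suc k * Y = \<alpha> * q * Y * q ^ k" by simp
    have "qpoch_inf q (\<alpha> * q * Y) = qpoch q (\<alpha> * q * Y) k * qpoch_inf q (\<alpha> * q ^ Suc k * Y)"
      unfolding e by (rule qpoch_inf_split[OF q(2)])
    then show ?thesis using nz by (simp add: \<Phi>_def)
  qed
  ultimately show ?thesis by (simp add: G_def h_def)
qed

end

section \<open>Reduction to one variable\<close>

text \<open>The power of \<open>q\<close> supplies one \<open>q ^ k s\<close> for each pair r < s,
  which clears the negative exponents in \<open>vdm_ratio\<close> and leaves a quotient of
  Vandermonde products in the points \<open>x s * q ^ k s\<close>.\<close>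

lemma vdm_ratio_conv:
  assumes q: "q \<noteq> 0" and x: "\<And>s. s \<in> {1..n} \<Longrightarrow> x s \<noteq> 0"
  shows "vdm_ratio q n x k * q ^ (\<Sum>r=1..n. (r - 1) * k r)
    = (\<Prod>r=1..n. \<Prod>s=r+1..n. x s * q ^ k s - x r * q ^ k r) / (\<Prod>r=1..n. \<Prod>s=r+1..n. x s - x r)"
proof -
  \<comment> \<open>The index \<open>s\<close> is the larger one in exactly \<open>s - 1\<close>
    pairs.\<close>
  have shift: "(\<Prod>r=1..N. \<Prod>s=r+1..N. f s) = (\<Prod>s=1..N. f s ^ (s - 1))"
    for f :: "nat \<Rightarrow> complex" and N
  proof (induction N)
    case (Suc N)
    have "(\<Prod>r=1..Suc N. \<Prod>s=r+1..Suc N. f s) = (\<Prod>r=1..N. (\<Prod>s=r+1..N. f s) * f (Suc N))"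
      by (simp add: prod.nat_ivl_Suc')
    also have "\<dots> = (\<Prod>s=1..N. f s ^ (s - 1)) * f (Suc N) ^ N"
      unfolding prod.distrib Suc by simp
    finally show ?case by simp
  qed simp
  have "q ^ (\<Sum>r=1..n. (r - 1) * k r) = (\<Prod>s=1..n. (q ^ k s) ^ (s - 1))"
    by (simp only: power_sum power_mult[symmetric] mult.commute)
  also have "\<dots> = (\<Prod>r=1..n. \<Prod>s=r+1..n. q ^ k s)"
    by (rule shift[symmetric])
  finally have "vdm_ratio q n x k * q ^ (\<Sum>r=1..n. (r - 1) * k r)
    = (\<Prod>r=1..n. \<Prod>s=r+1..n. (1 - q powi (int (k r) - int (k s)) * (x r / x s)) / (1 - x r / x s) * q ^ k s)"
    by (simp only: vdm_ratio_def prod.distrib[symmetric])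
  also have "\<dots> = (\<Prod>r=1..n. \<Prod>s=r+1..n. (x s * q ^ k s - x r * q ^ k r) / (x s - x r))"
  proof (intro prod.cong refl)
    fix r s assume rs: "r \<in> {1..n}" "s \<in> {r+1..n}"
    then have xs: "x s \<noteq> 0" using x by auto
    have "(1 - q powi (int (k r) - int (k s)) * (x r / x s)) * q ^ k s = (x s * q ^ k s - x r * q ^ k r) / x s"
      using xs q by (simp add: power_int_diff field_simps)
    moreover have "1 - x r / x s = (x s - x r) / x s"
      using xs by (simp add: field_simps)
    ultimately show "(1 - q powi (int (k r) - int (k s)) * (x r / x s)) / (1 - x r / x s) * q ^ k s
        = (x s * q ^ k s - x r * q ^ k r) / (x s - x r)"
      using xs by (simp add: divide_simps)
  qed
  finally show ?thesis by (simp only: prod_dividef)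
qed

lemma milne_term_eq_0:
  assumes r: "r \<in> {1..n}" and i: "i < k r" and 0: "a r - c r * x r * q ^ i = 0"
  shows "milne_term q n x a c k = 0"
proof -
  define F where "F = (\<lambda>r s. (\<Prod>i<k r. a s - c s * x r * q ^ i) / qpoch q (q * x r / x s) (k r))"
  have "(\<Prod>i<k r. a r - c r * x r * q ^ i) = 0"
    using i 0 by (intro prod_zero) blast+
  then have "F r r = 0" by (simp add: F_def)
  then have "(\<Prod>s=1..n. F r s) = 0"
    using r by (intro prod_zero) blast+
  then have "(\<Prod>r=1..n. \<Prod>s=1..n. F r s) = 0"
    using r by (intro prod_zero) blast+
  then show ?thesis by (simp add: milne_term_def F_def)
qed

text \<open>Convergence of the sums grouped by size is weaker than summability over multi-indices,
  hence the separate hypothesis; the grouped series then only identifies the value.\<close>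

lemma has_sum_by_size:
  fixes f :: "(nat \<Rightarrow> nat) \<Rightarrow> complex"
  assumes "f summable_on ({1..n} \<rightarrow>\<^sub>E UNIV)"
    and L: "(\<lambda>K. \<Sum>k\<in>multi_indices n K. f k) sums L"
  shows "(f has_sum L) ({1..n} \<rightarrow>\<^sub>E UNIV)"
proof -
  obtain S where S: "(f has_sum S) ({1..n} \<rightarrow>\<^sub>E UNIV)"
    using assms(1) by (auto simp: summable_on_def)
  have bij: "bij_betw snd (SIGMA K:UNIV. multi_indices n K) ({1..n} \<rightarrow>\<^sub>E UNIV)"
    by (rule bij_betw_byWitness[where f' = "\<lambda>k. (mi_size n k, k)"]) (auto simp: multi_indices_def)
  have "((\<lambda>p. f (snd p)) has_sum S) (SIGMA K:UNIV. multi_indices n K)"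
    using S has_sum_reindex_bij_betw[OF bij] by blast
  then have "((\<lambda>K. \<Sum>k\<in>multi_indices n K. f k) has_sum S) UNIV"
    by (rule has_sum_SigmaD) (auto intro!: has_sum_finiteI finite_multi_indices)
  then have "S = L" using L has_sum_imp_sums sums_unique2 by blast
  with S show ?thesis by simp
qed

lemma summable_power_mi_size:
  assumes "0 \<le> t" "t < (1::real)"
  shows "(\<lambda>k. t ^ mi_size n k) summable_on ({1..n} \<rightarrow>\<^sub>E UNIV)"
proof -
  have "Infinite_Set_Sum.abs_summable_on (\<lambda>k. t ^ k) (UNIV :: nat set)"
    using assms by (simp add: abs_summable_on_nat_iff')
  then have "Infinite_Set_Sum.abs_summable_on (\<lambda>k. \<Prod>r\<in>{1..n}. t ^ k r) ({1..n} \<rightarrow>\<^sub>E UNIV)"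
    by (intro abs_summable_on_prod_PiE) auto
  then have "(\<lambda>k. \<Prod>r\<in>{1..n}. t ^ k r) summable_on ({1..n} \<rightarrow>\<^sub>E UNIV)"
    using abs_summable_equivalent abs_summable_summable by blast
  then show ?thesis by (simp only: mi_size_def power_sum)
qed

section \<open>Evaluation and summability of the inner and outer sums\<close>

context
  fixes q :: complex and n :: nat and x :: "nat \<Rightarrow> complex"
  assumes q: "q \<noteq> 0" "cmod q < 1"
    and x_nz: "\<And>s. s \<in> {1..n} \<Longrightarrow> x s \<noteq> 0"
    and x_distinct: "\<And>r s. 1 \<le> r \<Longrightarrow> r < s \<Longrightarrow> s \<le> n \<Longrightarrow> 1 - x r / x s \<noteq> 0"
    and qx_nz: "\<And>r s K. r \<in> {1..n} \<Longrightarrow> s \<in> {1..n} \<Longrightarrow> qpoch q (q * x r / x s) K \<noteq> 0"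
begin

text \<open>The Vandermonde quotient is bounded since |q^k| is at most 1, and coordinate
  \<open>r\<close> contributes the product over \<open>s\<close> to the power \<open>k r\<close>.
  The slack \<open>e\<close> keeps the base positive when some \<open>a s\<close> is 0.\<close>

lemma milne_term_bound:
  fixes a c :: "nat \<Rightarrow> complex"
  assumes e: "e > 0"
  obtains C where "C > 0" "\<And>k. cmod (milne_term q n x a c k) \<le> C * (\<Prod>s=1..n. cmod (a s) + e) ^ mi_size n k"
proof -
  define X where "X = (\<Prod>r=1..n. \<Prod>s=r+1..n. x s - x r)"
  define B where "B = (\<Prod>r=1..n. \<Prod>s=r+1..n. cmod (x s) + cmod (x r))"
  have "\<exists>C>0. \<forall>k. cmod ((\<Prod>i<k. a s - c s * x r * q ^ i) / qpoch q (q * x r / x s) k) \<le> C * (cmod (a s) + e) ^ k"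
    if rs: "r \<in> {1..n}" "s \<in> {1..n}" for r s
  proof -
    obtain C1 where C1: "C1 > 0" "\<And>a' u k. cmod a' \<le> cmod (a s) + e \<Longrightarrow> cmod u \<le> cmod (c s * x r)
        \<Longrightarrow> cmod (\<Prod>i<k. a' - u * q ^ i) \<le> C1 * (cmod (a s) + e) ^ k"
      using norm_shifted_prod_bound[OF q(2), of "cmod (a s) + e" "cmod (c s * x r)"] e
      by (metis add_nonneg_pos norm_ge_zero)
    obtain C2 where C2: "C2 > 0" "\<And>k. cmod (1 / qpoch q (q * x r / x s) k) \<le> C2"
      using inverse_qpoch_bound[OF q(2) qx_nz[OF rs]] by blast
    have "cmod ((\<Prod>i<k. a s - c s * x r * q ^ i) / qpoch q (q * x r / x s) k) \<le> C1 * C2 * (cmod (a s) + e) ^ k" for k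
    proof -
      have "cmod ((\<Prod>i<k. a s - c s * x r * q ^ i) / qpoch q (q * x r / x s) k)
         = cmod (\<Prod>i<k. a s - c s * x r * q ^ i) * cmod (1 / qpoch q (q * x r / x s) k)"
        by (simp add: norm_divide)
      also have "\<dots> \<le> C1 * (cmod (a s) + e) ^ k * C2"
        using C1(1) C2(1) e by (intro mult_mono C1(2) C2(2)) auto
      finally show ?thesis by (simp add: mult_ac)
    qed
    then show ?thesis using C1(1) C2(1) by (intro exI[of _ "C1 * C2"]) auto
  qed
  then obtain C where C: "\<And>r s. r \<in> {1..n} \<Longrightarrow> s \<in> {1..n} \<Longrightarrow> C r s > 0"
    "\<And>r s k. r \<in> {1..n} \<Longrightarrow> s \<in> {1..n} \<Longrightarrow>
      cmod ((\<Prod>i<k. a s - c s * x r * q ^ i) / qpoch q (q * x r / x s) k) \<le> C r s * (cmod (a s) + e) ^ k"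
    by metis
  define K where "K = (\<Prod>r=1..n. \<Prod>s=1..n. C r s)"
  have K: "K > 0" unfolding K_def using C(1) by (intro prod_pos) auto
  have "cmod (milne_term q n x a c k) \<le> (B / cmod X * K + 1) * (\<Prod>s=1..n. cmod (a s) + e) ^ mi_size n k" for k
  proof -
    have V: "cmod (\<Prod>r=1..n. \<Prod>s=r+1..n. x s * q ^ k s - x r * q ^ k r) \<le> B"
      unfolding prod_norm[symmetric] B_def
    proof (intro prod_mono conjI prod_nonneg)
      fix r s
      have "cmod (x s * q ^ k s) \<le> cmod (x s)" for s
        using q by (simp add: norm_mult norm_power mult_left_le power_le_one)
      then show "cmod (x s * q ^ k s - x r * q ^ k r) \<le> cmod (x s) + cmod (x r)"
        by (meson add_mono norm_triangle_ineq4 order_trans)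
    qed auto
    have "cmod (\<Prod>r=1..n. \<Prod>s=1..n. (\<Prod>i<k r. a s - c s * x r * q ^ i) / qpoch q (q * x r / x s) (k r))
      \<le> (\<Prod>r=1..n. \<Prod>s=1..n. C r s * (cmod (a s) + e) ^ k r)"
      unfolding prod_norm[symmetric] by (intro prod_mono conjI prod_nonneg norm_ge_zero C(2)) auto
    also have "\<dots> = K * (\<Prod>r=1..n. (\<Prod>s=1..n. cmod (a s) + e) ^ k r)"
      by (simp add: prod.distrib K_def prod_power_distrib)
    also have "\<dots> = K * (\<Prod>s=1..n. cmod (a s) + e) ^ mi_size n k"
      by (simp only: mi_size_def power_sum)
    finally have D: "cmod (\<Prod>r=1..n. \<Prod>s=1..n. (\<Prod>i<k r. a s - c s * x r * q ^ i) / qpoch q (q * x r / x s) (k r))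
      \<le> K * (\<Prod>s=1..n. cmod (a s) + e) ^ mi_size n k" .
    have P: "(\<Prod>s=1..n. cmod (a s) + e) ^ mi_size n k \<ge> 0"
      using e by (intro zero_le_power prod_nonneg) (auto intro: add_nonneg_nonneg)
    have "cmod (milne_term q n x a c k) \<le> (B / cmod X) * (K * (\<Prod>s=1..n. cmod (a s) + e) ^ mi_size n k)"
      unfolding milne_term_def X_def[symmetric] norm_mult norm_divide[of _ X]
      using K P by (intro mult_mono divide_right_mono V D) (auto intro!: divide_nonneg_nonneg prod_nonneg simp: B_def)
    also have "\<dots> \<le> (B / cmod X * K + 1) * (\<Prod>s=1..n. cmod (a s) + e) ^ mi_size n k"
      using P by (simp add: algebra_simps)
    finally show ?thesis .
  qed
  moreover have "B / cmod X * K + 1 > 0"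
    using K by (auto intro!: add_nonneg_pos mult_nonneg_nonneg divide_nonneg_nonneg prod_nonneg simp: B_def)
  ultimately show ?thesis using that by blast
qed

text \<open>Milne's theorem with a_s = 1 and c_s = q^(-k_s) / x_s, for which the product of the c_s
  x_s is q^(-|k|). The box need not be imposed: outside it some diagonal factor, the one with s = r,
  vanishes, so the sum may run over all \<open>m\<close> of size at most |k|.\<close>

lemma inner_sum:
  fixes k :: "nat \<Rightarrow> nat" and H :: "nat \<Rightarrow> complex"
  shows "(\<Sum>m \<in> (\<Pi>\<^sub>E r\<in>{1..n}. {0..k r}).
      vdm_ratio q n x m
      * (\<Prod>r=1..n. \<Prod>s=1..n. qpoch q (q powi (- int (k s)) * (x r / x s)) (m r) / qpoch q (q * x r / x s) (m r))
      * H (mi_size n m) * q ^ (\<Sum>r=1..n. r * m r))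
    = qsum q (mi_size n k) H"
proof -
  define c where "c = (\<lambda>s. q powi (- int (k s)) / x s)"
  define t where "t = milne_term q n x (\<lambda>_. 1) c"
  have vanish: "t m = 0" if m: "r \<in> {1..n}" "m r > k r" for m r
  proof -
    have "1 - c r * x r * q ^ k r = 0"
      using q x_nz[OF m(1)] by (simp add: c_def power_int_minus)
    then show ?thesis
      unfolding t_def by (rule milne_term_eq_0[where k = m, OF m])
  qed
  have eq: "vdm_ratio q n x m
      * (\<Prod>r=1..n. \<Prod>s=1..n. qpoch q (q powi (- int (k s)) * (x r / x s)) (m r) / qpoch q (q * x r / x s) (m r))
      * H (mi_size n m) * q ^ (\<Sum>r=1..n. r * m r) = t m * (H (mi_size n m) * q ^ mi_size n m)" for m
  proof -
    have "(\<Sum>r=1..n. r * m r) = (\<Sum>r=1..n. (r - 1) * m r) + mi_size n m"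
      unfolding mi_size_def sum.distrib[symmetric]
      by (rule sum.cong) (auto simp: algebra_simps diff_mult_distrib)
    then have 1: "q ^ (\<Sum>r=1..n. r * m r) = q ^ (\<Sum>r=1..n. (r - 1) * m r) * q ^ mi_size n m"
      by (simp only: power_add)
    have 2: "(\<Prod>r=1..n. \<Prod>s=1..n. (\<Prod>i<m r. 1 - c s * x r * q ^ i) / qpoch q (q * x r / x s) (m r))
      = (\<Prod>r=1..n. \<Prod>s=1..n. qpoch q (q powi (- int (k s)) * (x r / x s)) (m r) / qpoch q (q * x r / x s) (m r))"
      by (simp add: c_def qpoch_def)
    have 3: "(\<Prod>r=1..n. \<Prod>s=r+1..n. x s * q ^ m s - x r * q ^ m r) / (\<Prod>r=1..n. \<Prod>s=r+1..n. x s - x r)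
      = vdm_ratio q n x m * q ^ (\<Sum>r=1..n. (r - 1) * m r)"
      by (rule vdm_ratio_conv[OF q(1) x_nz, symmetric])
    show ?thesis
      unfolding t_def milne_term_def 1 2 3
      by (simp only: mult_ac)
  qed
  have "(\<Sum>m \<in> (\<Pi>\<^sub>E r\<in>{1..n}. {0..k r}). t m * (H (mi_size n m) * q ^ mi_size n m))
    = (\<Sum>m \<in> (\<Union>M\<le>mi_size n k. multi_indices n M). t m * (H (mi_size n m) * q ^ mi_size n m))"
  proof (rule sum.mono_neutral_left)
    show "finite (\<Union>M\<le>mi_size n k. multi_indices n M)"
      using finite_multi_indices by blast
    show "(\<Pi>\<^sub>E r\<in>{1..n}. {0..k r}) \<subseteq> (\<Union>M\<le>mi_size n k. multi_indices n M)"
      by (auto simp: multi_indices_def mi_size_def PiE_iff intro!: sum_mono)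
    show "\<forall>m\<in>(\<Union>M\<le>mi_size n k. multi_indices n M) - (\<Pi>\<^sub>E r\<in>{1..n}. {0..k r}).
        t m * (H (mi_size n m) * q ^ mi_size n m) = 0"
    proof
      fix m assume "m \<in> (\<Union>M\<le>mi_size n k. multi_indices n M) - (\<Pi>\<^sub>E r\<in>{1..n}. {0..k r})"
      then obtain r where "r \<in> {1..n}" "m r > k r"
        by (auto simp: multi_indices_def PiE_iff not_le)
      then show "t m * (H (mi_size n m) * q ^ mi_size n m) = 0" using vanish by simp
    qed
  qed
  also have "\<dots> = (\<Sum>M\<le>mi_size n k. \<Sum>m\<in>multi_indices n M. t m * (H (mi_size n m) * q ^ mi_size n m))"
    by (rule sum.UNION_disjoint) (simp_all add: finite_multi_indices, auto simp: multi_indices_def)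
  also have "\<dots> = (\<Sum>M\<le>mi_size n k. (\<Sum>m\<in>multi_indices n M. t m) * (H M * q ^ M))"
    unfolding sum_distrib_right by (intro sum.cong refl) (auto simp: multi_indices_def)
  also have "\<dots> = qsum q (mi_size n k) H"
  proof -
    have "(\<Prod>s=1..n. c s * x s) = (\<Prod>s=1..n. inverse q ^ k s)"
      by (rule prod.cong) (use x_nz in \<open>auto simp: c_def power_int_minus power_inverse\<close>)
    also have "\<dots> = inverse q ^ mi_size n k"
      by (simp only: mi_size_def power_sum)
    finally have "(\<Prod>s=1..n. c s * x s) = q powi (- int (mi_size n k))"
      by (simp add: power_int_minus power_inverse)
    then have "(\<Sum>m\<in>multi_indices n M. t m) = qpoch q (q powi (- int (mi_size n k))) M / qpoch q q M" for M
      unfolding t_def using milne_fundamental[where q = q and n = n and x = x, OF q x_nz x_distinct qx_nz, where a = "\<lambda>_. 1" and c = c and K = M]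
      by (simp add: qpoch_def)
    then show ?thesis by (simp add: qsum_def mult_ac)
  qed
  finally show ?thesis unfolding eq .
qed

text \<open>Milne's theorem with c_s = q / x_s, for which the product of the c_s x_s is q^n. Each
  numerator factor is then q^n times (Y - q^i), and the powers of q^n cancel against the weight
  q^(-n|k|).\<close>

lemma outer_sum:
  fixes a :: "nat \<Rightarrow> complex" and g :: "nat \<Rightarrow> complex"
  shows "(\<Sum>k\<in>multi_indices n K. milne_term q n x a (\<lambda>s. q / x s) k * (g (mi_size n k) / (q ^ n) ^ mi_size n k))
    = (\<Prod>i<K. (\<Prod>s=1..n. a s) / q ^ n - q ^ i) / qpoch q q K * g K"
proof -
  have c: "(\<Prod>s=1..n. q / x s * x s) = q ^ n"
  proof -
    have "(\<Prod>s=1..n. q / x s * x s) = (\<Prod>s=1..n. q)"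
      by (rule prod.cong) (use x_nz in auto)
    then show ?thesis by simp
  qed
  have "(\<Sum>k\<in>multi_indices n K. milne_term q n x a (\<lambda>s. q / x s) k * (g (mi_size n k) / (q ^ n) ^ mi_size n k))
    = (\<Sum>k\<in>multi_indices n K. milne_term q n x a (\<lambda>s. q / x s) k) * (g K / (q ^ n) ^ K)"
    unfolding sum_distrib_right by (rule sum.cong) (auto simp: multi_indices_def)
  also have "(\<Sum>k\<in>multi_indices n K. milne_term q n x a (\<lambda>s. q / x s) k)
     = (\<Prod>i<K. (\<Prod>s=1..n. a s) - q ^ n * q ^ i) / qpoch q q K"
    using milne_fundamental[where q = q and n = n and x = x, OF q x_nz x_distinct qx_nz, where a = a and c = "\<lambda>s. q / x s" and K = K] unfolding c .
  also have "(\<Prod>i<K. (\<Prod>s=1..n. a s) - q ^ n * q ^ i) = (\<Prod>i<K. q ^ n * ((\<Prod>s=1..n. a s) / q ^ n - q ^ i))"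
    by (rule prod.cong) (use q in \<open>auto simp: field_simps\<close>)
  also have "\<dots> = (q ^ n) ^ K * (\<Prod>i<K. (\<Prod>s=1..n. a s) / q ^ n - q ^ i)"
    by (simp add: prod.distrib)
  finally show ?thesis using q by simp
qed

lemma outer_summable:
  fixes a :: "nat \<Rightarrow> complex" and g :: "nat \<Rightarrow> complex"
  assumes r: "0 \<le> r" "r * cmod (\<Prod>s=1..n. a s) < cmod q ^ n"
    and g: "\<And>\<rho>. \<rho> > r \<Longrightarrow> \<exists>C>0. \<forall>K. cmod (g K) \<le> C * \<rho> ^ K"
  shows "(\<lambda>k. milne_term q n x a (\<lambda>s. q / x s) k * (g (mi_size n k) / (q ^ n) ^ mi_size n k))
    summable_on ({1..n} \<rightarrow>\<^sub>E UNIV)"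
proof -
  have qn: "cmod q ^ n > 0" using q by simp
  \<comment> \<open>The strict inequality leaves room to enlarge every |a s| and the rate by the
    same \<open>e\<close>; the resulting ratio \<open>t\<close> stays below 1 and dominates the
    terms by \<open>t ^ mi_size n k\<close>.\<close>
  obtain e where e: "e > 0" "(\<Prod>s=1..n. cmod (a s) + e) * (r + e) / cmod q ^ n < 1"
  proof -
    have "((\<lambda>e. (\<Prod>s=1..n. cmod (a s) + e) * (r + e) / cmod q ^ n)
        \<longlongrightarrow> (\<Prod>s=1..n. cmod (a s) + 0) * (r + 0) / cmod q ^ n) (at_right 0)"
      by (intro tendsto_intros) (use q in auto)
    then have "\<forall>\<^sub>F e in at_right 0. (\<Prod>s=1..n. cmod (a s) + e) * (r + e) / cmod q ^ n < 1"
      by (rule order_tendstoD(2)) (use r qn in \<open>simp add: prod_norm mult.commute\<close>)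
    moreover have "\<forall>\<^sub>F e in at_right (0::real). e > 0"
      by (rule eventually_at_right_less)
    ultimately have "\<forall>\<^sub>F e in at_right 0. e > 0 \<and> (\<Prod>s=1..n. cmod (a s) + e) * (r + e) / cmod q ^ n < 1"
      by eventually_elim auto
    then show ?thesis using that eventually_happens'[OF trivial_limit_at_right_real] by blast
  qed
  define t where "t = (\<Prod>s=1..n. cmod (a s) + e) * (r + e) / cmod q ^ n"
  have t: "0 \<le> t" "t < 1"
    using e r(1) by (auto simp: t_def intro!: divide_nonneg_nonneg mult_nonneg_nonneg prod_nonneg add_nonneg_nonneg)
  obtain C1 where C1: "C1 > 0"
    "\<And>k. cmod (milne_term q n x a (\<lambda>s. q / x s) k) \<le> C1 * (\<Prod>s=1..n. cmod (a s) + e) ^ mi_size n k"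
    using milne_term_bound[OF e(1)] by blast
  obtain C2 where C2: "C2 > 0" "\<And>K. cmod (g K) \<le> C2 * (r + e) ^ K"
    using g[of "r + e"] e by auto
  have "cmod (milne_term q n x a (\<lambda>s. q / x s) k * (g (mi_size n k) / (q ^ n) ^ mi_size n k))
     \<le> C1 * C2 * t ^ mi_size n k" for k
  proof -
    have "cmod (milne_term q n x a (\<lambda>s. q / x s) k * (g (mi_size n k) / (q ^ n) ^ mi_size n k))
      \<le> (C1 * (\<Prod>s=1..n. cmod (a s) + e) ^ mi_size n k) * ((C2 * (r + e) ^ mi_size n k) / (cmod q ^ n) ^ mi_size n k)"
      unfolding norm_mult norm_divide norm_power
      using e r C1(1) by (intro mult_mono C1(2) divide_right_mono C2(2))
        (auto intro!: mult_nonneg_nonneg zero_le_power prod_nonneg add_nonneg_nonneg)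
    also have "\<dots> = C1 * C2 * t ^ mi_size n k"
      by (simp add: t_def power_mult_distrib power_divide)
    finally show ?thesis .
  qed
  then have "(\<lambda>k. norm (milne_term q n x a (\<lambda>s. q / x s) k * (g (mi_size n k) / (q ^ n) ^ mi_size n k)))
      summable_on ({1..n} \<rightarrow>\<^sub>E UNIV)"
    by (intro Infinite_Sum.abs_summable_on_comparison_test'[OF summable_on_cmult_right[OF summable_power_mi_size[OF t]]])
  then show ?thesis by (rule abs_summable_summable)
qed

lemma outer_summable_terminating:
  fixes a :: "nat \<Rightarrow> complex" and g :: "(nat \<Rightarrow> nat) \<Rightarrow> complex"
  assumes N: "\<And>r. r \<in> {1..n} \<Longrightarrow> N r > 0 \<and> a r = q ^ N r"
  shows "(\<lambda>k. milne_term q n x a (\<lambda>s. q / x s) k * g k) summable_on ({1..n} \<rightarrow>\<^sub>E UNIV)"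
proof -
  have vanish: "milne_term q n x a (\<lambda>s. q / x s) k = 0" if r: "r \<in> {1..n}" "k r \<ge> N r" for k r
  proof -
    \<comment> \<open>The vanishing diagonal factor has index \<open>N r - 1\<close>, which is where
      \<open>N r > 0\<close> matters; it is present as soon as \<open>k r \<ge> N r\<close>.\<close>
    have e: "a r - q / x r * x r * q ^ (N r - 1) = 0"
      using q x_nz[OF r(1)] N[OF r(1)] by (simp flip: power_Suc)
    have l: "N r - 1 < k r" using r(2) conjunct1[OF N[OF r(1)]] by linarith
    show ?thesis
      by (rule milne_term_eq_0[where a = a and c = "\<lambda>s. q / x s" and k = k and x = x and q = q, OF r(1) l e])
  qed
  have "(\<lambda>k. milne_term q n x a (\<lambda>s. q / x s) k * g k) summable_on (\<Pi>\<^sub>E r\<in>{1..n}. {..<N r})"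
    by (intro summable_on_finite finite_PiE) auto
  then show ?thesis
  proof (rule summable_on_cong_neutral[THEN iffD1, rotated -1])
    fix k assume "k \<in> ({1..n} \<rightarrow>\<^sub>E UNIV) - (\<Pi>\<^sub>E r\<in>{1..n}. {..<N r})"
    then obtain r where "r \<in> {1..n}" "k r \<ge> N r"
      by (auto simp: PiE_iff not_less)
    then show "milne_term q n x a (\<lambda>s. q / x s) k * g k = 0" using vanish by simp
  qed auto
qed

end

section \<open>Assembly in the convergent and the terminating regime\<close>

theorem theorem1p9:
  fixes q \<alpha> \<beta> \<gamma> b c d :: complex
    and a x :: "nat \<Rightarrow> complex"
    and n :: nat
  assumes q: "0 < cmod q" "cmod q < 1"
    and n: "n \<ge> 1"
    and conv_or_term:
      "Max {cmod (\<alpha> * (\<Prod>s=1..n. a s) * q powi (1 - int n)),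
            cmod (\<alpha> * b), cmod (\<alpha> * c), cmod (\<alpha> * d),
            cmod (\<alpha> * \<beta> * (\<Prod>s=1..n. a s) / q ^ n),
            cmod (\<alpha> * \<gamma> * (\<Prod>s=1..n. a s) / q ^ n)} < 1
       \<or> (\<exists>N :: nat \<Rightarrow> nat. \<forall>r\<in>{1..n}. N r > 0 \<and> a r = q ^ N r)"
    and denom_lhs:
      "qpochs_inf q [\<alpha> * (\<Prod>s=1..n. a s) * q powi (1 - int n), \<alpha> * b, \<alpha> * c, \<alpha> * d,
                     \<alpha> * \<beta> * (\<Prod>s=1..n. a s) / q ^ n,
                     \<alpha> * \<gamma> * (\<Prod>s=1..n. a s) / q ^ n] \<noteq> 0"
    and denom_x: "\<And>s. s \<in> {1..n} \<Longrightarrow> x s \<noteq> 0"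
    and denom_vdm: "\<And>r s. 1 \<le> r \<Longrightarrow> r < s \<Longrightarrow> s \<le> n \<Longrightarrow> 1 - x r / x s \<noteq> 0"
    and denom_qx: "\<And>r s K. r \<in> {1..n} \<Longrightarrow> s \<in> {1..n} \<Longrightarrow> qpoch q (q * x r / x s) K \<noteq> 0"
    and denom_alpha: "1 - \<alpha> \<noteq> 0"
    and denom_outer: "\<And>K. qpoch q (\<alpha> * (\<Prod>s=1..n. a s) * q powi (1 - int n)) K \<noteq> 0"
    and denom_inner: "\<And>M. qpochs q [\<alpha> * b, \<alpha> * c, \<alpha> * d] M \<noteq> 0"
  shows
    "((\<lambda>k. vdm_ratio q n x k
          * (num_factor q n x k a / (\<Prod>r=1..n. \<Prod>s=1..n. qpoch q (q * x r / x s) (k r)))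
          * (((1 - \<alpha> * q ^ (2 * mi_size n k)) * qpoch q \<alpha> (mi_size n k))
             / ((1 - \<alpha>) * qpoch q (\<alpha> * (\<Prod>s=1..n. a s) * q powi (1 - int n)) (mi_size n k)))
          * q powi ((\<Sum>r=1..n. (int r - 1) * int (k r)) - int n * int (mi_size n k))
          * (\<Sum>m \<in> (\<Pi>\<^sub>E r\<in>{1..n}. {0..k r}).
               vdm_ratio q n x m
               * (\<Prod>r=1..n. \<Prod>s=1..n.
                    qpoch q (q powi (- int (k s)) * (x r / x s)) (m r)
                    / qpoch q (q * x r / x s) (m r))
               * (qpochs q [\<alpha> * q ^ mi_size n k, \<alpha> * \<beta>, \<alpha> * \<gamma>] (mi_size n m)
                  / qpochs q [\<alpha> * b, \<alpha> * c, \<alpha> * d] (mi_size n m))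
               * q ^ (\<Sum>r=1..n. r * m r)))
      has_sum
        (qpochs_inf q [\<alpha> * q, \<alpha> * (\<Prod>s=1..n. a s) * b / q ^ n,
                       \<alpha> * (\<Prod>s=1..n. a s) * c / q ^ n,
                       \<alpha> * (\<Prod>s=1..n. a s) * d / q ^ n, \<alpha> * \<beta>, \<alpha> * \<gamma>]
         / qpochs_inf q [\<alpha> * (\<Prod>s=1..n. a s) * q powi (1 - int n), \<alpha> * b, \<alpha> * c, \<alpha> * d,
                         \<alpha> * \<beta> * (\<Prod>s=1..n. a s) / q ^ n,
                         \<alpha> * \<gamma> * (\<Prod>s=1..n. a s) / q ^ n]))
     ({1..n} \<rightarrow>\<^sub>E (UNIV :: nat set))"
proof -
  define A where "A = (\<Prod>s=1..n. a s)"
  define Y where "Y = A / q ^ n"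
  define h where "h = qratio q (\<alpha> * \<beta>) (\<alpha> * \<gamma>) (\<alpha> * b) (\<alpha> * c) (\<alpha> * d)"
  \<comment> \<open>\<open>expansion_coeff\<close> carries the 1 / (q)_K that
    \<open>outer_sum\<close> produces only after summing over a fixed size; the factor
    \<open>qpoch q q K\<close> takes it out of the individual terms.\<close>
  define g where "g = (\<lambda>K. expansion_coeff q \<alpha> h K * qpoch q q K / qpoch q (\<alpha> * q * Y) K)"
  define f where "f = (\<lambda>k. milne_term q n x a (\<lambda>s. q / x s) k * (g (mi_size n k) / (q ^ n) ^ mi_size n k))"
  define L where "L = qpoch_inf q (\<alpha> * q) / qpoch_inf q (\<alpha> * q * Y)
    * qratio_inf q (\<alpha> * \<beta>) (\<alpha> * \<gamma>) (\<alpha> * b) (\<alpha> * c) (\<alpha> * d) Y"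
  have q0: "q \<noteq> 0" using q by auto
  note qq = q0 q(2)
  have qn0: "q ^ n \<noteq> 0" using q0 by simp
  have \<alpha>: "\<alpha> \<noteq> 1" using denom_alpha by auto
  have e1: "\<alpha> * A * q powi (1 - int n) = \<alpha> * q * Y"
    using q0 by (simp add: Y_def power_int_diff)
  have e2: "\<alpha> * A * z / q ^ n = \<alpha> * z * Y" "\<alpha> * z * A / q ^ n = \<alpha> * z * Y" for z
    by (simp_all add: Y_def)
  have nz: "qpoch_inf q (\<alpha> * q * Y) \<noteq> 0" "qpoch_inf q (\<alpha> * b) \<noteq> 0" "qpoch_inf q (\<alpha> * c) \<noteq> 0"
    "qpoch_inf q (\<alpha> * d) \<noteq> 0" "qpoch_inf q (\<alpha> * \<beta> * Y) \<noteq> 0" "qpoch_inf q (\<alpha> * \<gamma> * Y) \<noteq> 0"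
    using denom_lhs unfolding A_def[symmetric] e1 e2 by (simp_all add: qpochs_inf_def)
  have nzk: "qpoch q (\<alpha> * q * Y) k \<noteq> 0" "qpoch q (\<alpha> * b) k \<noteq> 0" "qpoch q (\<alpha> * c) k \<noteq> 0"
    "qpoch q (\<alpha> * d) k \<noteq> 0" for k
    using nz qpoch_inf_nonzero_iff[OF q(2)] by auto
  have L: "L = qpochs_inf q [\<alpha> * q, \<alpha> * A * b / q ^ n, \<alpha> * A * c / q ^ n, \<alpha> * A * d / q ^ n, \<alpha> * \<beta>, \<alpha> * \<gamma>]
         / qpochs_inf q [\<alpha> * A * q powi (1 - int n), \<alpha> * b, \<alpha> * c, \<alpha> * d,
                         \<alpha> * \<beta> * A / q ^ n, \<alpha> * \<gamma> * A / q ^ n]"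
    unfolding e1 e2 by (simp add: L_def qratio_inf_def qpochs_inf_def mult_ac)
  have summand: "vdm_ratio q n x k
          * (num_factor q n x k a / (\<Prod>r=1..n. \<Prod>s=1..n. qpoch q (q * x r / x s) (k r)))
          * (((1 - \<alpha> * q ^ (2 * mi_size n k)) * qpoch q \<alpha> (mi_size n k))
             / ((1 - \<alpha>) * qpoch q (\<alpha> * A * q powi (1 - int n)) (mi_size n k)))
          * q powi ((\<Sum>r=1..n. (int r - 1) * int (k r)) - int n * int (mi_size n k))
          * (\<Sum>m \<in> (\<Pi>\<^sub>E r\<in>{1..n}. {0..k r}).
               vdm_ratio q n x m
               * (\<Prod>r=1..n. \<Prod>s=1..n.
                    qpoch q (q powi (- int (k s)) * (x r / x s)) (m r)
                    / qpoch q (q * x r / x s) (m r))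
               * (qpochs q [\<alpha> * q ^ mi_size n k, \<alpha> * \<beta>, \<alpha> * \<gamma>] (mi_size n m)
                  / qpochs q [\<alpha> * b, \<alpha> * c, \<alpha> * d] (mi_size n m))
               * q ^ (\<Sum>r=1..n. r * m r)) = f k" for k
  proof -
    let ?K = "mi_size n k"
    have inner: "(\<Sum>m \<in> (\<Pi>\<^sub>E r\<in>{1..n}. {0..k r}).
               vdm_ratio q n x m
               * (\<Prod>r=1..n. \<Prod>s=1..n.
                    qpoch q (q powi (- int (k s)) * (x r / x s)) (m r)
                    / qpoch q (q * x r / x s) (m r))
               * (qpochs q [\<alpha> * q ^ ?K, \<alpha> * \<beta>, \<alpha> * \<gamma>] (mi_size n m)
                  / qpochs q [\<alpha> * b, \<alpha> * c, \<alpha> * d] (mi_size n m))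
               * q ^ (\<Sum>r=1..n. r * m r))
        = qsum q ?K (\<lambda>M. qpochs q [\<alpha> * q ^ ?K, \<alpha> * \<beta>, \<alpha> * \<gamma>] M / qpochs q [\<alpha> * b, \<alpha> * c, \<alpha> * d] M)"
      by (rule inner_sum[where x = x, OF qq denom_x denom_vdm denom_qx])
    have H: "qpochs q [\<alpha> * q ^ ?K, \<alpha> * \<beta>, \<alpha> * \<gamma>] M / qpochs q [\<alpha> * b, \<alpha> * c, \<alpha> * d] M
        = qpoch q (\<alpha> * q ^ ?K) M * h M" for M
      by (simp add: qpochs_def h_def qratio_def)
    \<comment> \<open>In polynomial form the extension by continuity agrees with the numerators of
      \<open>milne_term\<close>, which covers vanishing \<open>a s\<close>.\<close>
    have num: "num_factor q n x k a / (\<Prod>r=1..n. \<Prod>s=1..n. qpoch q (q * x r / x s) (k r))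
        = (\<Prod>r=1..n. \<Prod>s=1..n. (\<Prod>i<k r. a s - q / x s * x r * q ^ i) / qpoch q (q * x r / x s) (k r))"
      unfolding num_factor_eq_poly num_factor_poly_def prod_dividef[symmetric]
      by (intro prod.cong refl) (simp add: mult_ac)
    have "(\<Sum>r=1..n. (int r - 1) * int (k r)) = int (\<Sum>r=1..n. (r - 1) * k r)"
      unfolding of_nat_sum by (rule sum.cong) (auto simp: of_nat_diff)
    then have pw: "q powi ((\<Sum>r=1..n. (int r - 1) * int (k r)) - int n * int ?K)
        = q ^ (\<Sum>r=1..n. (r - 1) * k r) / (q ^ n) ^ ?K"
      using q0 by (simp only: power_int_diff simp_thms of_nat_mult[symmetric] power_int_of_nat power_mult)
    have V: "vdm_ratio q n x k * q ^ (\<Sum>r=1..n. (r - 1) * k r)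
      = (\<Prod>r=1..n. \<Prod>s=r+1..n. x s * q ^ k s - x r * q ^ k r) / (\<Prod>r=1..n. \<Prod>s=r+1..n. x s - x r)"
      by (rule vdm_ratio_conv[where x = x, OF q0 denom_x])
    have "f k = vdm_ratio q n x k * q ^ (\<Sum>r=1..n. (r - 1) * k r)
       * (num_factor q n x k a / (\<Prod>r=1..n. \<Prod>s=1..n. qpoch q (q * x r / x s) (k r)))
       * (g ?K / (q ^ n) ^ ?K)"
      unfolding f_def milne_term_def num V ..
    moreover have "g ?K = ((1 - \<alpha> * q ^ (2 * ?K)) * qpoch q \<alpha> ?K)
             / ((1 - \<alpha>) * qpoch q (\<alpha> * q * Y) ?K) * qsum q ?K (\<lambda>M. qpoch q (\<alpha> * q ^ ?K) M * h M)"
      using qpoch_self_nonzero[OF q(2), of ?K] by (simp add: g_def expansion_coeff_def)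
    ultimately show ?thesis
      unfolding inner unfolding H pw e1 by (simp add: mult_ac)
  qed
  have sizes: "(\<Sum>k\<in>multi_indices n K. f k)
      = expansion_coeff q \<alpha> h K * (\<Prod>i<K. Y - q ^ i) / qpoch q (\<alpha> * q * Y) K" for K
  proof -
    have "(\<Sum>k\<in>multi_indices n K. f k)
        = (\<Prod>i<K. (\<Prod>s=1..n. a s) / q ^ n - q ^ i) / qpoch q q K * g K"
      unfolding f_def by (rule outer_sum[where x = x, OF qq denom_x denom_vdm denom_qx])
    then show ?thesis
      using qpoch_self_nonzero[OF q(2), of K] by (simp add: g_def Y_def A_def)
  qed
  have "f summable_on ({1..n} \<rightarrow>\<^sub>E UNIV) \<and> (\<lambda>K. \<Sum>k\<in>multi_indices n K. f k) sums L"
    using conv_or_term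
  proof
    assume "Max {cmod (\<alpha> * (\<Prod>s=1..n. a s) * q powi (1 - int n)),
            cmod (\<alpha> * b), cmod (\<alpha> * c), cmod (\<alpha> * d),
            cmod (\<alpha> * \<beta> * (\<Prod>s=1..n. a s) / q ^ n),
            cmod (\<alpha> * \<gamma> * (\<Prod>s=1..n. a s) / q ^ n)} < 1"
    then have uY: "cmod (\<alpha> * \<beta> * Y) < 1" "cmod (\<alpha> * \<gamma> * Y) < 1"
      unfolding A_def[symmetric] e2 by simp_all
    define r where "r = max (cmod (\<alpha> * \<beta>)) (cmod (\<alpha> * \<gamma>))"
    \<comment> \<open>The last two entries of the maximum are |\<alpha> \<beta> Y| and |\<alpha>
      \<gamma> Y|, so they bound exactly the growth rate times |Y|.\<close>
    have "r * cmod Y < 1"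
      using uY by (simp add: r_def max_def norm_mult)
    then have r: "0 \<le> r" "r * cmod (\<Prod>s=1..n. a s) < cmod q ^ n"
      using q0 by (simp_all add: r_def max_def Y_def A_def norm_divide norm_power divide_less_eq)
    have growth: "dd_growth q r h"
      unfolding r_def h_def by (rule dd_growth_qratio[OF qq nzk(2-4)])
    have g_bound: "\<exists>C>0. \<forall>K. cmod (g K) \<le> C * \<rho> ^ K" if \<rho>: "\<rho> > r" for \<rho>
    proof -
      obtain C1 where C1: "C1 > 0" "\<And>k. cmod (expansion_coeff q \<alpha> h k) \<le> C1 * \<rho> ^ k"
        using expansion_coeff_growth[OF qq r(1) growth \<rho>] by blast
      obtain C2 where C2: "C2 > 0" "\<And>u k. cmod u \<le> 1 \<Longrightarrow> cmod (qpoch q u k) \<le> C2"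
        using qpoch_bound[OF q(2), of 1] by auto
      obtain C3 where C3: "C3 > 0" "\<And>k. cmod (1 / qpoch q (\<alpha> * q * Y) k) \<le> C3"
        using inverse_qpoch_bound[OF q(2) nzk(1)] by blast
      have "cmod (g K) \<le> C1 * C2 * C3 * \<rho> ^ K" for K
      proof -
        have "cmod (g K) = cmod (expansion_coeff q \<alpha> h K) * cmod (qpoch q q K) * cmod (1 / qpoch q (\<alpha> * q * Y) K)"
          by (simp add: g_def norm_mult norm_divide)
        also have "\<dots> \<le> C1 * \<rho> ^ K * C2 * C3"
          using C1(1) C2(1) C3(1) \<rho> r(1) q by (intro mult_mono C1(2) C2(2) C3(2)) auto
        finally show ?thesis by (simp add: mult_ac)
      qed
      then show ?thesis using C1(1) C2(1) C3(1) by (intro exI[of _ "C1 * C2 * C3"]) auto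
    qed
    have "f summable_on ({1..n} \<rightarrow>\<^sub>E UNIV)"
      unfolding f_def by (rule outer_summable[where x = x, OF qq denom_x denom_vdm denom_qx r g_bound])
    moreover have "(\<lambda>K. \<Sum>k\<in>multi_indices n K. f k) sums L"
      unfolding sizes L_def h_def by (rule qratio_expansion[OF qq \<alpha> nz(2-4) uY nz(1)])
    ultimately show ?thesis ..
  next
    assume "\<exists>N :: nat \<Rightarrow> nat. \<forall>r\<in>{1..n}. N r > 0 \<and> a r = q ^ N r"
    then obtain N :: "nat \<Rightarrow> nat" where N: "\<And>r. r \<in> {1..n} \<Longrightarrow> N r > 0 \<and> a r = q ^ N r" by blast
    \<comment> \<open>Here Y is q to the power N_1 + ... + N_n - n. Subtracting 1 from each N_r is
      exact on natural numbers because every N_r is positive.\<close>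
    define M where "M = (\<Sum>r=1..n. N r - 1)"
    have "(\<Sum>r=1..n. N r) = (\<Sum>r=1..n. (N r - 1) + 1)"
      by (rule sum.cong) (use N in force)+
    then have "(\<Sum>r=1..n. N r) = M + n"
      by (simp only: M_def sum.distrib) simp
    then have "q ^ (M + n) = (\<Prod>r=1..n. q ^ N r)"
      by (simp only: power_sum[symmetric])
    also have "\<dots> = A"
      unfolding A_def by (rule prod.cong) (use N in auto)
    finally have "A = q ^ (M + n)" ..
    then have Y: "Y = q ^ M" using q0 by (simp add: Y_def power_add)
    have e3: "\<alpha> * q ^ Suc M = \<alpha> * q * q ^ M" by simp
    have "f summable_on ({1..n} \<rightarrow>\<^sub>E UNIV)"
      unfolding f_def by (rule outer_summable_terminating[where x = x, OF qq denom_x denom_vdm denom_qx N])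
    moreover have "(\<lambda>K. \<Sum>k\<in>multi_indices n K. f k) sums L"
      using qratio_expansion_terminating[OF qq \<alpha> nz(2-4), where M = M] nz(1,5,6)
      unfolding sizes L_def h_def Y e3 by blast
    ultimately show ?thesis ..
  qed
  then have "(f has_sum L) ({1..n} \<rightarrow>\<^sub>E UNIV)"
    using has_sum_by_size by blast
  then show ?thesis
    unfolding A_def[symmetric] summand L .
qed

end
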